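(* Let $X_1,X_2,\dots$ be i.i.d. random variables with values in the two-letter ordered alphabet $\{\alpha_1<\alpha_2\}$ and $\mathbb{P}(X_i=\alpha_1)=\mathbb{P}(X_i=\alpha_2)=1/2$. Let $LI_n$ be the length of the longest (weakly) increasing subsequence of $X_1,\dots,X_n$, and let $(B(t))_{t\in[0,1]}$ be a standard one-dimensional Brownian motion. Then for every integer $n\ge1$, $$\sup_{x\in\mathbb{R}}\left|\mathbb{P}\left(\frac{LI_n-n/2}{\sqrt n}\ge x\right)-\mathbb{P}\left(-\frac{B(1)}{2}+\max_{t\in[0,1]}B(t)\ge x\right)\right|\le\frac{24}{\sqrt n}.$$
   Context: $LI_n=\max\{j: X_{i_1}\le X_{i_2}\le\dots\le X_{i_j}\text{ for some }1\le i_1<i_2<\dots<i_j\le n\}$. *)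

theory Defs
  imports "HOL-Probability.Probability"
begin

(* Position 0 of the sequence is unused. The length j = 0 is always admissible, so the maximum is
   over a nonempty set, which is bounded by n. *)
definition longest_incr_subseq :: "(nat \<Rightarrow> 'l::linorder) \<Rightarrow> nat \<Rightarrow> nat" where
  "longest_incr_subseq x n =
     Max {j. \<exists>i :: nat \<Rightarrow> nat. strict_mono_on {1..j} i \<and> i ` {1..j} \<subseteq> {1..n} \<and>
                mono_on {1..j} (\<lambda>k. x (i k))}"

(* All paths (not merely almost all) start at 0 and are continuous on the unit interval; this makes
   the path maximum an everywhere defined random variable. Values B t with t outside the unit
   interval are irrelevant. The second parameter of the normal density is the standard deviation. *)
locale standard_brownian_motion = prob_space N for N :: "'b measure" +
  fixes B :: "real \<Rightarrow> 'b \<Rightarrow> real"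
  assumes random_variable_B: "\<And>t. t \<in> {0..1} \<Longrightarrow> random_variable borel (B t)"
    and start_0: "\<And>\<omega>. \<omega> \<in> space N \<Longrightarrow> B 0 \<omega> = 0"
    and continuous_paths: "\<And>\<omega>. \<omega> \<in> space N \<Longrightarrow> continuous_on {0..1} (\<lambda>t. B t \<omega>)"
    and independent_increments:
      "\<And>(k::nat) (t::nat \<Rightarrow> real). mono_on {0..k} t \<Longrightarrow> t ` {0..k} \<subseteq> {0..1} \<Longrightarrow>
         indep_vars (\<lambda>_. borel) (\<lambda>i \<omega>. B (t (Suc i)) \<omega> - B (t i) \<omega>) {..<k}"
    and normal_increments:
      "\<And>s t. 0 \<le> s \<Longrightarrow> s < t \<Longrightarrow> t \<le> 1 \<Longrightarrow>
         distributed N lborel (\<lambda>\<omega>. B t \<omega> - B s \<omega>) (\<lambda>x. ennreal (normal_density 0 (sqrt (t - s)) x))"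

end

theory Submission
  imports Defs
begin

text \<open>
  Let \<open>S\<close> be the walk that steps up at the letter \<open>\<alpha>\<^sub>1\<close> and down at \<open>\<alpha>\<^sub>2\<close>. An increasing
  subsequence consists of letters \<open>\<alpha>\<^sub>1\<close> up to some time \<open>k\<close> and letters \<open>\<alpha>\<^sub>2\<close> afterwards, so that
  \<open>2 * LI n - n = 2 * max S - S n\<close>, to be compared with \<open>2 * max B - B 1\<close>. The reflection principle
  for walks with independent symmetric increments gives both laws explicitly: for the walk directly,
  for the Brownian motion by letting the mesh of a time grid tend to zero. With \<open>L = n + 1\<close> and
  \<open>j = m + 1\<close>, the walk has mass \<open>2 * j\<^sup>2 / L * P (S L = j)\<close> at \<open>m\<close>, and
  \<open>P (S L = j) \<le> c * exp (- j\<^sup>2 / (2 * (L + 1)))\<close> where \<open>c\<close> is asymptotically \<open>sqrt (2 / (pi * L))\<close>.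
  Comparing the sum of these bounds with an integral, their total is \<open>1 + O (1 / sqrt n)\<close>; since the
  point masses add up to one, the upper bounds alone control the tails from both sides.
\<close>

section \<open>The reflection principle for symmetric walks\<close>

text \<open>A maximum is no sum of independent terms, and a functional limit theorem carries no
  rate; hence both laws are computed in closed form and compared. The independence hypothesis on the
  Brownian motion speaks of finitely many times only, so its law comes from grid walks with Gaussian
  steps. This replaces the strong Markov property, at the price of an overshoot when a grid walk
  passes a level. Reflection therefore comes in an exact version for unit steps and in two one-sided
  versions for general steps. The constant 24 makes the claim trivial for n < 576 = 24^2, where the
  bound exceeds 1; for larger n the error is at most 14 / sqrt n. The Gaussian exponent has L + 1 in
  its denominator because the ratios of neighbouring binomial coefficients and of neighbouring
  exponentials then fit together.\<close>

locale symmetric_walk = prob_space +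
  fixes \<xi> :: "nat \<Rightarrow> 'a \<Rightarrow> real" and m :: nat
  assumes indep: "indep_vars (\<lambda>_. borel) \<xi> {..<m}"
    and symmetric: "\<And>i. i < m \<Longrightarrow> distr M borel (\<lambda>\<omega>. - \<xi> i \<omega>) = distr M borel (\<xi> i)"
begin

definition S :: "nat \<Rightarrow> 'a \<Rightarrow> real" where
  "S k \<omega> = (\<Sum>i<k. \<xi> i \<omega>)"

definition first_passage :: "real \<Rightarrow> nat \<Rightarrow> 'a \<Rightarrow> bool" where
  "first_passage a k \<omega> \<longleftrightarrow> a \<le> S k \<omega> \<and> (\<forall>l<k. S l \<omega> < a)"

lemma measurable_step [measurable]: "i < m \<Longrightarrow> \<xi> i \<in> borel_measurable M"
  using indep by (auto simp: indep_vars_def)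

lemma measurable_S [measurable]: "k \<le> m \<Longrightarrow> S k \<in> borel_measurable M"
  unfolding S_def[abs_def] by (intro borel_measurable_sum measurable_step) auto

lemma ex_first_passage: "(\<exists>k\<le>j. a \<le> S k \<omega>) \<longleftrightarrow> (\<exists>k\<le>j. first_passage a k \<omega>)"
proof
  assume "\<exists>k\<le>j. a \<le> S k \<omega>"
  then obtain k where k: "k \<le> j" "a \<le> S k \<omega>" by auto
  define l where "l = (LEAST l. a \<le> S l \<omega>)"
  have "a \<le> S l \<omega>" "l \<le> k" "\<forall>i<l. S i \<omega> < a"
    unfolding l_def using k by (auto intro: LeastI Least_le dest: not_less_Least simp:
      not_le[symmetric])
  then show "\<exists>k\<le>j. first_passage a k \<omega>" using k unfolding first_passage_def
    by (intro exI[of _ l]) auto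
qed (auto simp: first_passage_def)

lemma first_passage_unique: "first_passage a k \<omega> \<Longrightarrow> first_passage a l \<omega> \<Longrightarrow> k = l"
  unfolding first_passage_def by (metis linorder_neqE_nat not_le)

text \<open>The time \<open>k\<close> is fixed here. By independence the joint law is the product of
  the step laws, and by symmetry each factor survives a change of sign.\<close>

lemma flip_law:
  "distr M (\<Pi>\<^sub>M i\<in>{..<m}. borel) (\<lambda>\<omega>. \<lambda>i\<in>{..<m}. if i < k then \<xi> i \<omega> else - \<xi> i \<omega>)
   = distr M (\<Pi>\<^sub>M i\<in>{..<m}. borel) (\<lambda>\<omega>. \<lambda>i\<in>{..<m}. \<xi> i \<omega>)"
\<comment> \<open>Reading independence as a product law needs a nonempty index set; without steps
  both maps coincide.\<close>
proof (cases "m = 0")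
  case False
  let ?\<xi>' = "\<lambda>i \<omega>. if i < k then \<xi> i \<omega> else - \<xi> i \<omega>"
  have rv: "?\<xi>' i \<in> borel_measurable M" if "i \<in> {..<m}" for i
    using that by (cases "i < k") auto
  have "indep_vars (\<lambda>_. borel) (\<lambda>i \<omega>. (\<lambda>x. if i < k then x else - x) (\<xi> i \<omega>)) {..<m}"
    by (rule indep_vars_compose2[OF indep]) (simp split: if_splits)
  then have "distr M (\<Pi>\<^sub>M i\<in>{..<m}. borel) (\<lambda>\<omega>. \<lambda>i\<in>{..<m}. ?\<xi>' i \<omega>)
    = (\<Pi>\<^sub>M i\<in>{..<m}. distr M borel (?\<xi>' i))"
    using False by (intro indep_vars_iff_distr_eq_PiM'[THEN iffD1] rv) auto
  also have "\<dots> = (\<Pi>\<^sub>M i\<in>{..<m}. distr M borel (\<xi> i))"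
  proof (intro PiM_cong refl)
    fix i assume "i \<in> {..<m}"
    then show "distr M borel (?\<xi>' i) = distr M borel (\<xi> i)"
      using symmetric[of i] by (cases "i < k") auto
  qed
  also have "\<dots> = distr M (\<Pi>\<^sub>M i\<in>{..<m}. borel) (\<lambda>\<omega>. \<lambda>i\<in>{..<m}. \<xi> i \<omega>)"
    using False indep by (intro indep_vars_iff_distr_eq_PiM'[THEN iffD1, symmetric]) auto
  finally show ?thesis .
qed (auto intro!: arg_cong[where f="distr M _"] simp: restrict_def)

text \<open>Passage at time \<open>k\<close> is decided by the first \<open>k\<close> steps, which
  the flip keeps, whereas the end point \<open>S m\<close> turns into
  \<open>2 * S k - S m\<close>.\<close>

lemma reflection_at:
  assumes [measurable]: "C \<in> sets borel" and k: "k \<le> m"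
  shows "prob {\<omega> \<in> space M. first_passage a k \<omega> \<and> S m \<omega> \<in> C}
       = prob {\<omega> \<in> space M. first_passage a k \<omega> \<and> 2 * S k \<omega> - S m \<omega> \<in> C}"
proof -
  let ?P = "\<Pi>\<^sub>M i\<in>{..<m}. (borel :: real measure)"
  define T :: "nat \<Rightarrow> (nat \<Rightarrow> real) \<Rightarrow> real" where "T j x = (\<Sum>i<j. x i)" for j x
  have [measurable]: "T j \<in> borel_measurable ?P" if "j \<le> m" for j
    unfolding T_def[abs_def] using that by (intro borel_measurable_sum
      measurable_component_singleton) auto
  \<comment> \<open>Both events are preimages of this one set of step sequences, under the original
    steps \<open>f\<close> and the flipped steps \<open>g\<close>.\<close>
  define A where "A = {x \<in> space ?P. a \<le> T k x \<and> (\<forall>l\<in>{..<k}. T l x < a) \<and> T m x \<in> C}"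
  have A: "A \<in> sets ?P"
  proof -
    have "Measurable.pred ?P (\<lambda>x. a \<le> T k x)" "Measurable.pred ?P (\<lambda>x. T m x \<in> C)"
      using k by measurable
    moreover have "Measurable.pred ?P (\<lambda>x. \<forall>l\<in>{..<k}. T l x < a)"
      using k by (intro pred_intros_finite) (auto intro!: borel_measurable_pred_less)
    ultimately show ?thesis unfolding A_def by measurable
  qed
  define f where "f \<omega> = (\<lambda>i\<in>{..<m}. \<xi> i \<omega>)" for \<omega>
  define g where "g \<omega> = (\<lambda>i\<in>{..<m}. if i < k then \<xi> i \<omega> else - \<xi> i \<omega>)" for \<omega>
  have f: "f \<in> measurable M ?P" unfolding f_def by (intro measurable_restrict) auto
  have g: "g \<in> measurable M ?P" unfolding g_def
    by (intro measurable_restrict) (auto split: if_splits)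
  have Tf: "T j (f \<omega>) = S j \<omega>" if "j \<le> m" for j \<omega>
    unfolding T_def f_def S_def using that by (intro sum.cong) auto
  have Tg: "T j (g \<omega>) = S j \<omega>" if "j \<le> k" for j \<omega>
    unfolding T_def g_def S_def using that k by (intro sum.cong) auto
  have Tgm: "T m (g \<omega>) = 2 * S k \<omega> - S m \<omega>" for \<omega>
  proof -
    have m: "{..<m} = {..<k} \<union> {k..<m}" using k by auto
    have "T m (g \<omega>) = (\<Sum>i<k. \<xi> i \<omega>) + (\<Sum>i=k..<m. - \<xi> i \<omega>)"
      unfolding T_def m g_def by (subst sum.union_disjoint) (auto intro!: arg_cong2[where f="(+)"]
        sum.cong)
    moreover have "S m \<omega> = (\<Sum>i<k. \<xi> i \<omega>) + (\<Sum>i=k..<m. \<xi> i \<omega>)"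
      unfolding S_def m by (subst sum.union_disjoint) auto
    ultimately show ?thesis by (simp add: S_def sum_negf)
  qed
  have "{\<omega> \<in> space M. first_passage a k \<omega> \<and> S m \<omega> \<in> C} = f -` A \<inter> space M"
    using measurable_space[OF f] k by (auto simp: A_def first_passage_def Tf)
  moreover have "{\<omega> \<in> space M. first_passage a k \<omega> \<and> 2 * S k \<omega> - S m \<omega> \<in> C} = g -` A \<inter> space M"
    using measurable_space[OF g] k by (auto simp: A_def first_passage_def Tg Tgm)
  moreover have "measure (distr M ?P f) A = measure (distr M ?P g) A"
    using flip_law[of k] unfolding f_def g_def by simp
  ultimately show ?thesis using A f g by (simp add: measure_distr)
qed

text \<open>The passage time is random, but it takes finitely many values on disjoint events, so the
  fixed-time identities add up.\<close>

lemma reflection: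
  assumes [measurable]: "C \<in> sets borel"
  shows "prob {\<omega> \<in> space M. \<exists>k\<le>m. first_passage a k \<omega> \<and> S m \<omega> \<in> C}
       = prob {\<omega> \<in> space M. \<exists>k\<le>m. first_passage a k \<omega> \<and> 2 * S k \<omega> - S m \<omega> \<in> C}"
proof -
  have [measurable]: "Measurable.pred M (first_passage a k)" if "k \<le> m" for k
  proof -
    have [measurable]: "Measurable.pred M (\<lambda>\<omega>. \<forall>l\<in>{..<k}. S l \<omega> < a)"
      using that by (intro pred_intros_finite) (auto intro!: borel_measurable_pred_less)
    have "Measurable.pred M (\<lambda>\<omega>. a \<le> S k \<omega> \<and> (\<forall>l\<in>{..<k}. S l \<omega> < a))"
      using that by measurable
    then show ?thesis by (simp add: first_passage_def[abs_def] Ball_def)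
  qed
  have *: "prob {\<omega> \<in> space M. \<exists>k\<le>m. first_passage a k \<omega> \<and> Q k \<omega>}
    = (\<Sum>k\<le>m. prob {\<omega> \<in> space M. first_passage a k \<omega> \<and> Q k \<omega>})"
    if [measurable]: "\<And>k. k \<le> m \<Longrightarrow> Measurable.pred M (Q k)" for Q
  proof -
    have "{\<omega> \<in> space M. \<exists>k\<le>m. first_passage a k \<omega> \<and> Q k \<omega>}
      = (\<Union>k\<in>{..m}. {\<omega> \<in> space M. first_passage a k \<omega> \<and> Q k \<omega>})" by auto
    then show ?thesis
      by (simp, intro finite_measure_finite_Union)
         (auto simp: disjoint_family_on_def dest: first_passage_unique)
  qed
  show ?thesis
    by (subst (1 2) *) (auto intro!: sum.cong reflection_at)
qed

text \<open>\<open>hit\<close> excludes overshoot, so the reflection takes place exactly at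
  \<open>a\<close>. On the reflected side passage is automatic: if \<open>2 * a - S m\<close> lies
  in \<open>C\<close>, then \<open>S m\<close> is at least \<open>a\<close>.\<close>

lemma hitting_reflection:
  assumes C: "C \<in> sets borel"
    and hit: "\<And>k \<omega>. \<omega> \<in> space M \<Longrightarrow> k \<le> m \<Longrightarrow> first_passage a k \<omega> \<Longrightarrow> S k \<omega> = a"
    and ge: "\<And>c. c \<in> C \<Longrightarrow> c \<le> a"
  shows "prob {\<omega> \<in> space M. (\<exists>k\<le>m. a \<le> S k \<omega>) \<and> S m \<omega> \<in> C}
       = prob {\<omega> \<in> space M. 2 * a - S m \<omega> \<in> C}"
proof -
  have "prob {\<omega> \<in> space M. (\<exists>k\<le>m. a \<le> S k \<omega>) \<and> S m \<omega> \<in> C}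
     = prob {\<omega> \<in> space M. \<exists>k\<le>m. first_passage a k \<omega> \<and> S m \<omega> \<in> C}"
    by (intro arg_cong[where f=prob]) (auto simp: ex_first_passage)
  also have "\<dots> = prob {\<omega> \<in> space M. \<exists>k\<le>m. first_passage a k \<omega> \<and> 2 * S k \<omega> - S m \<omega> \<in> C}"
    by (rule reflection[OF C])
  also have "\<dots> = prob {\<omega> \<in> space M. 2 * a - S m \<omega> \<in> C}"
  proof (intro arg_cong[where f=prob] Collect_cong conj_cong refl iffI)
    fix \<omega> assume \<omega>: "\<omega> \<in> space M"
    show "2 * a - S m \<omega> \<in> C" if "\<exists>k\<le>m. first_passage a k \<omega> \<and> 2 * S k \<omega> - S m \<omega> \<in> C"
      using that hit[OF \<omega>] by auto
    assume C: "2 * a - S m \<omega> \<in> C"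
    then have "a \<le> S m \<omega>" using ge by fastforce
    then have "\<exists>k\<le>m. first_passage a k \<omega>" unfolding ex_first_passage[symmetric] by auto
    then show "\<exists>k\<le>m. first_passage a k \<omega> \<and> 2 * S k \<omega> - S m \<omega> \<in> C"
      using C hit[OF \<omega>] by auto
  qed
  finally show ?thesis .
qed

text \<open>Overshoot only helps in this direction: \<open>S k\<close> at passage is at least
  \<open>a\<close>, so a reflected value of at most \<open>c\<close> puts the end point at or above
  \<open>2 * a - c\<close>.\<close>

lemma hitting_upper:
  "prob {\<omega> \<in> space M. (\<exists>k\<le>m. a \<le> S k \<omega>) \<and> S m \<omega> \<le> c} \<le> prob {\<omega> \<in> space M. 2 * a - c \<le> S m \<omega>}"
proof -
  have [measurable]: "S m \<in> borel_measurable M" by simp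
  have "prob {\<omega> \<in> space M. (\<exists>k\<le>m. a \<le> S k \<omega>) \<and> S m \<omega> \<le> c}
     = prob {\<omega> \<in> space M. \<exists>k\<le>m. first_passage a k \<omega> \<and> S m \<omega> \<in> {..c}}"
    by (intro arg_cong[where f=prob]) (auto simp: ex_first_passage)
  also have "\<dots> = prob {\<omega> \<in> space M. \<exists>k\<le>m. first_passage a k \<omega> \<and> 2 * S k \<omega> - S m \<omega> \<in> {..c}}"
    by (rule reflection) simp
  also have "\<dots> \<le> prob {\<omega> \<in> space M. 2 * a - c \<le> S m \<omega>}"
    by (intro finite_measure_mono) (auto simp: first_passage_def)
  finally show ?thesis .
qed

lemma measurable_first_passage: "k \<le> m \<Longrightarrow> {\<omega> \<in> space M. first_passage a k \<omega> \<and> 2 * S k \<omega> - S m \<omega>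
  \<le> c} \<in> sets M"
proof -
  assume k: "k \<le> m"
  have [measurable]: "S m \<in> borel_measurable M" "S k \<in> borel_measurable M" using k by auto
  have [measurable]: "Measurable.pred M (\<lambda>\<omega>. \<forall>l\<in>{..<k}. S l \<omega> < a)"
    using k by (intro pred_intros_finite) (auto intro!: borel_measurable_pred_less)
  have "{\<omega> \<in> space M. (a \<le> S k \<omega> \<and> (\<forall>l\<in>{..<k}. S l \<omega> < a)) \<and> 2 * S k \<omega> - S m \<omega> \<le> c} \<in> sets M"
    by measurable
  then show ?thesis unfolding first_passage_def Ball_def lessThan_iff .
qed

text \<open>Unless some step exceeds \<open>\<delta>\<close>, the walk passes \<open>a\<close> by at
  most \<open>\<delta>\<close>. The overshoot enters the reflected value twice, whence
  \<open>2 * \<delta>\<close>.\<close>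

lemma hitting_lower:
  assumes "0 \<le> a" "c \<le> a" "0 \<le> \<delta>"
  shows "prob {\<omega> \<in> space M. 2 * a + 2 * \<delta> - c \<le> S m \<omega>} \<le>
    prob {\<omega> \<in> space M. (\<exists>k\<le>m. a \<le> S k \<omega>) \<and> S m \<omega> \<le> c} + prob {\<omega> \<in> space M. \<exists>k<m. \<delta> < \<xi> k \<omega>}"
proof -
  let ?A = "{\<omega> \<in> space M. \<exists>k\<le>m. first_passage a k \<omega> \<and> 2 * S k \<omega> - S m \<omega> \<in> {..c}}"
  let ?B = "{\<omega> \<in> space M. \<exists>k<m. \<delta> < \<xi> k \<omega>}"
  have "?A = (\<Union>k\<in>{..m}. {\<omega> \<in> space M. first_passage a k \<omega> \<and> 2 * S k \<omega> - S m \<omega> \<le> c})" by auto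
  also have "\<dots> \<in> sets M" by (intro sets.finite_UN measurable_first_passage) auto
  finally have A: "?A \<in> sets M" .
  have "?B = (\<Union>k\<in>{..<m}. {\<omega> \<in> space M. \<delta> < \<xi> k \<omega>})" by auto
  also have "\<dots> \<in> sets M" by (intro sets.finite_UN) auto
  finally have B: "?B \<in> sets M" .
  have "{\<omega> \<in> space M. 2 * a + 2 * \<delta> - c \<le> S m \<omega>} \<subseteq> ?A \<union> ?B"
  proof (intro subsetI, rule ccontr)
    fix \<omega> assume \<omega>: "\<omega> \<in> {\<omega> \<in> space M. 2 * a + 2 * \<delta> - c \<le> S m \<omega>}" "\<omega> \<notin> ?A \<union> ?B"
    then have step: "\<xi> k \<omega> \<le> \<delta>" if "k < m" for k using that by force
    have "a \<le> S m \<omega>" using \<omega>(1) assms by auto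
    then obtain k where k: "k \<le> m" "first_passage a k \<omega>" using ex_first_passage[of m a \<omega>] by auto
    have "S k \<omega> \<le> a + \<delta>"
    proof (cases k)
      case 0
      then show ?thesis using assms by (simp add: S_def)
    next
      case (Suc l)
      then have "S l \<omega> < a" using k by (auto simp: first_passage_def)
      moreover have "S k \<omega> = S l \<omega> + \<xi> l \<omega>" using Suc by (simp add: S_def)
      moreover have "\<xi> l \<omega> \<le> \<delta>" using Suc k by (intro step) auto
      ultimately show ?thesis by linarith
    qed
    then have "2 * S k \<omega> - S m \<omega> \<le> c" using \<omega>(1) by auto
    with \<omega> k show False by auto
  qed
  then have "prob {\<omega> \<in> space M. 2 * a + 2 * \<delta> - c \<le> S m \<omega>} \<le> prob (?A \<union> ?B)"
    using A B by (intro finite_measure_mono sets.Un)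
  also have "\<dots> \<le> prob ?A + prob ?B" using A B by (rule measure_Un_le)
  finally have le: "prob {\<omega> \<in> space M. 2 * a + 2 * \<delta> - c \<le> S m \<omega>} \<le> prob ?A + prob ?B" .
  have "prob ?A = prob {\<omega> \<in> space M. \<exists>k\<le>m. first_passage a k \<omega> \<and> S m \<omega> \<in> {..c}}"
    by (rule reflection[symmetric]) simp
  also have "\<dots> = prob {\<omega> \<in> space M. (\<exists>k\<le>m. a \<le> S k \<omega>) \<and> S m \<omega> \<le> c}"
    by (intro arg_cong[where f=prob]) (auto simp: ex_first_passage)
  finally show ?thesis using le by (simp only:)
qed

end

section \<open>A Gaussian bound for binomial coefficients\<close>

text \<open>The sequence \<open>(b N)\<^sup>2 * N\<close> increases, and the Wallis product
  identifies its limit as \<open>1 / pi\<close>.\<close>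

lemma central_binomial_le: "real ((2 * N) choose N) / 4 ^ N \<le> sqrt (1 / (pi * real N))"
  if "N \<ge> 1" for N
proof -
  define b where "b N = real ((2 * N) choose N) / 4 ^ N" for N
  define w where "w n = (\<Prod>k=1..n. (4*real k^2) / (4*real k^2 - 1))" for n
  have b_Suc: "b (Suc N) = b N * (2 * real N + 1) / (2 * real N + 2)" for N
  proof -
    have "Suc N * ((2 * Suc N) choose Suc N) = 2 * (2 * N + 1) * ((2 * N) choose N)"
      using Suc_times_binomial_eq[of "2*N+1" N] Suc_times_binomial_add[of N N]
        binomial_symmetric[of "N" "2*N+1"] Suc_times_binomial_eq[of "2*N" N]
      by (simp add: algebra_simps)
    then have "real (Suc N) * real ((2 * Suc N) choose Suc N)
      = 2 * (2 * real N + 1) * real ((2 * N) choose N)"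
      by (metis (mono_tags, opaque_lifting) of_nat_1 of_nat_add of_nat_mult of_nat_numeral)
    then show ?thesis unfolding b_def
      by (simp add: divide_simps del: mult_Suc_right binomial_Suc_Suc) (simp add: algebra_simps
        del: mult_Suc_right binomial_Suc_Suc)
  qed
  \<comment> \<open>Ties the normalised central coefficients to the partial Wallis products
    \<open>w\<close>.\<close>
  have bw: "(b N)\<^sup>2 * (2 * real N + 1) * w N = 1" for N
  proof (induction N)
    case (Suc N)
    have "w (Suc N) = w N * ((2 * real N + 2)\<^sup>2 / ((2 * real N + 1) * (2 * real N + 3)))"
      unfolding w_def by (simp add: power2_eq_square algebra_simps)
    then have "(b (Suc N))\<^sup>2 * (2 * real (Suc N) + 1) * w (Suc N)
      = (b N)\<^sup>2 * (2 * real N + 1) * w N"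
      unfolding b_Suc by (simp add: divide_simps power2_eq_square) (simp add: algebra_simps)
    with Suc show ?case by simp
  qed (simp add: b_def w_def)
  have inc: "(b N)\<^sup>2 * real N \<le> (b (Suc N))\<^sup>2 * real (Suc N)" for N
  proof -
    \<comment> \<open>This is \<open>4 * N * (N + 1) \<le> (2 * N + 1)\<^sup>2\<close>
      rearranged.\<close>
    have "real N \<le> ((2 * real N + 1) / (2 * real N + 2))\<^sup>2 * real (Suc N)"
      by (simp add: divide_simps power2_eq_square) (simp add: algebra_simps)
    from mult_left_mono[OF this, of "(b N)\<^sup>2"] show ?thesis unfolding b_Suc
      by (simp add: power_mult_distrib power_divide mult_ac)
  qed
  have "(\<lambda>n. (real n / (2 * real n + 1)) / w n) \<longlonglongrightarrow> (1 / 2) / (pi / 2)"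
  proof (rule tendsto_divide)
    show "(\<lambda>n. real n / (2 * real n + 1)) \<longlonglongrightarrow> 1 / 2" by real_asymp
    show "w \<longlonglongrightarrow> pi / 2" unfolding w_def[abs_def] by (rule wallis)
  qed simp
  moreover have "(real n / (2 * real n + 1)) / w n = (b n)\<^sup>2 * real n" for n
  proof -
    have "w n \<noteq> 0" using bw[of n] by auto
    then show ?thesis using bw[of n] by (simp add: divide_simps)
  qed
  ultimately have lim: "(\<lambda>n. (b n)\<^sup>2 * real n) \<longlonglongrightarrow> 1 / pi" by simp
  have "incseq (\<lambda>n. (b n)\<^sup>2 * real n)" by (rule incseq_SucI) (rule inc)
  from incseq_le[OF this lim] have "(b N)\<^sup>2 * real N \<le> 1 / pi" .
  then have "(b N)\<^sup>2 \<le> 1 / (pi * real N)" using that by (simp add: field_simps)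
  then show ?thesis unfolding b_def[symmetric] by (rule real_le_rsqrt)
qed

text \<open>After cross-multiplication the difference \<open>f\<close> of the two sides vanishes at
  0 and has derivative \<open>t * (exp t - exp (- t))\<close>.\<close>

lemma ratio_le_exp: "(1 - t) / (1 + t) \<le> exp (- 2 * t)" if "0 \<le> t" for t :: real
proof -
  define f where "f t = (1 + t) * exp (- t) - (1 - t) * exp t" for t :: real
  have "f 0 \<le> f t"
  proof (rule DERIV_nonneg_imp_nondecreasing[OF that])
    fix x :: real assume "0 \<le> x" "x \<le> t"
    then show "\<exists>y. (f has_real_derivative y) (at x) \<and> 0 \<le> y"
      unfolding f_def
      by (intro exI[of _ "x * (exp x - exp (- x))"] conjI)
         (auto intro!: derivative_eq_intros mult_left_mono simp: algebra_simps)
  qed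
  then have "(1 - t) * exp t \<le> (1 + t) * exp (- t)" by (simp add: f_def)
  then have "(1 - t) * exp t * exp (- t) \<le> (1 + t) * exp (- t) * exp (- t)"
    by (rule mult_right_mono) simp
  then have "1 - t \<le> (1 + t) * exp (- 2 * t)" by (simp add: mult.assoc flip: exp_add)
  with that show ?thesis by (simp add: divide_simps mult.commute)
qed

text \<open>With \<open>u = L - 2 * i - 1\<close> the coefficients have ratio exactly
  \<open>(v - u) / (v + u)\<close>, and the exponents differ by
  \<open>((u + 1)\<^sup>2 - (u - 1)\<^sup>2) / (2 * v) = 2 * u / v\<close>. This is
  \<open>ratio_le_exp\<close> at \<open>t = u / v\<close>.\<close>

lemma binomial_gaussian_step:
  assumes "2 * Suc i \<le> L"
  defines "v \<equiv> real L + 1"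
  shows "real (L choose i) * exp ((real L - 2 * real i)\<^sup>2 / (2 * v))
     \<le> real (L choose Suc i) * exp ((real L - 2 * real (Suc i))\<^sup>2 / (2 * v))"
proof -
  define u where "u = real L - 2 * real i - 1"
  have u: "0 \<le> u" "u < v" "0 < v" using assms by (auto simp: u_def v_def)
  have "Suc i * (L choose Suc i) = (L - i) * (L choose i)"
    using binomial_absorption[of i L] binomial_absorb_comp[of L i] by simp
  then have "real (Suc i) * real (L choose Suc i) = real (L - i) * real (L choose i)"
    by (metis of_nat_mult)
  moreover have "real (Suc i) = (v - u) / 2" "real (L - i) = (v + u) / 2"
    using assms by (auto simp: u_def v_def of_nat_diff)
  ultimately have "(v - u) * real (L choose Suc i) = (v + u) * real (L choose i)"
    by (simp del: of_nat_Suc binomial_Suc_Suc)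
  then have "real (L choose i) = real (L choose Suc i) * ((v - u) / (v + u))" using u
    by (simp add: field_simps)
  also have "(v - u) / (v + u) = (1 - u / v) / (1 + u / v)" using u by (simp add: divide_simps)
  also have "\<dots> \<le> exp (- 2 * (u / v))" using u by (intro ratio_le_exp) auto
  finally have "real (L choose i) \<le> real (L choose Suc i) * exp (- 2 * (u / v))"
    by (simp add: mult_left_mono)
  then have "real (L choose i) * exp ((u + 1)\<^sup>2 / (2 * v))
     \<le> real (L choose Suc i) * exp (- 2 * (u / v)) * exp ((u + 1)\<^sup>2 / (2 * v))"
    by (rule mult_right_mono) simp
  also have "\<dots> = real (L choose Suc i) * exp ((u - 1)\<^sup>2 / (2 * v))"
    using u by (simp add: mult.assoc flip: exp_add) (simp add: field_simps power2_eq_square)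
  finally show ?thesis by (simp add: u_def algebra_simps)
qed

text \<open>The coefficient times the inverse Gaussian increases in \<open>i\<close> up to the
  middle, so the central estimate controls it everywhere.\<close>

lemma binomial_gaussian_bound:
  assumes "L \<ge> 1" "2 * i \<le> L"
  shows "real (L choose i) / 2 ^ L \<le> sqrt (2 / (pi * real L)) * exp (1 / (2 * (real L + 1)))
           * exp (- (real L - 2 * real i)\<^sup>2 / (2 * (real L + 1)))"
proof -
  define v where "v = real L + 1"
  define g where "g i = real (L choose i) * exp ((real L - 2 * real i)\<^sup>2 / (2 * v))" for i
  define N where "N = L div 2"
  have "i \<le> N" using assms by (simp add: N_def)
  then have mono: "g i \<le> g N"
  proof (induction rule: inc_induct)
    case (step k)
    have "g k \<le> g (Suc k)" unfolding g_def v_def using step.hyps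
      by (intro binomial_gaussian_step) (auto simp: N_def)
    with step show ?case by simp
  qed simp
  have "g N \<le> 2 ^ L * (sqrt (2 / (pi * real L)) * exp (1 / (2 * v)))"
  proof (cases "even L")
    case True
    then have L: "L = 2 * N" by (simp add: N_def)
    have "(4::real) ^ N = 2 ^ L" by (simp add: L power_mult)
    then have "real (L choose N) \<le> 2 ^ L * (sqrt (2 / (pi * real L)))"
      using central_binomial_le[of N] assms L by (simp add: field_simps)
    moreover have "1 \<le> exp (1 / (2 * v))" by (simp add: v_def)
    ultimately have "real (L choose N) * 1 \<le> 2 ^ L * (sqrt (2 / (pi * real L))) * exp (1 / (2 * v))"
      by (intro mult_mono) auto
    then show ?thesis by (simp add: g_def L)
  next
    \<comment> \<open>For odd \<open>L\<close> the middle index is at distance 1 from the centre,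
      which produces the factor \<open>exp (1 / (2 * v))\<close>; the coefficient is half the
      central one of order \<open>L + 1\<close>. Even \<open>L\<close> has the factor to
      spare.\<close>
    case False
    then have L: "L = 2 * N + 1" by (simp add: N_def)
    have "2 * (L choose N) = (2 * (N + 1)) choose (N + 1)"
      using binomial_symmetric[of N "2 * N + 1"] by (simp add: L)
    then have eq: "real (L choose N) = real ((2 * (N + 1)) choose (N + 1)) / 2"
      by (metis (mono_tags) nonzero_mult_div_cancel_left of_nat_mult of_nat_numeral
        zero_neq_numeral)
    have "real (L choose N) \<le> 2 ^ L * sqrt (1 / (pi * real (N + 1)))"
    proof -
      have "(2::real) ^ L = 4 ^ (N + 1) / 2" by (simp add: L power_mult)
      then show ?thesis unfolding eq using central_binomial_le[of "N + 1"]
        by (simp add: field_simps del: binomial_Suc_Suc mult_Suc_right)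
    qed
    also have "sqrt (1 / (pi * real (N + 1))) \<le> sqrt (2 / (pi * real L))"
      by (simp add: L divide_simps) 
    finally have "real (L choose N) \<le> 2 ^ L * sqrt (2 / (pi * real L))" by simp
    then show ?thesis by (simp add: g_def L mult.assoc[symmetric])
  qed
  with mono have "real (L choose i) * exp ((real L - 2 * real i)\<^sup>2 / (2 * v))
     \<le> 2 ^ L * (sqrt (2 / (pi * real L)) * exp (1 / (2 * v)))"
    unfolding g_def by linarith
  then show ?thesis unfolding v_def by (simp add: exp_minus field_simps)
qed

section \<open>Gaussian and Bessel tails\<close>

definition gauss_tail :: "real \<Rightarrow> real" where
  "gauss_tail y = measure (density lborel std_normal_density) {y..}"

interpretation std_normal: prob_space "density lborel std_normal_density"
  by (rule prob_space_normal_density) simp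

lemma std_normal_singleton: "measure (density lborel std_normal_density) {y} = 0"
proof -
  have "emeasure (density lborel std_normal_density) {y} = 0"
    by (subst emeasure_density) (auto intro!: nn_integral_0_iff_AE[THEN iffD2] AE_I[where N="{y}"]
      split: split_indicator)
  then show ?thesis by (simp add: measure_def)
qed

lemma gauss_tail_nonneg: "0 \<le> gauss_tail y"
  unfolding gauss_tail_def by simp

lemma std_normal_distr:
  assumes "prob_space M" "distributed M lborel Z std_normal_density" "A \<in> sets borel"
  shows "measure M {\<omega> \<in> space M. Z \<omega> \<in> A} = measure (density lborel std_normal_density) A"
proof -
  have [measurable]: "Z \<in> borel_measurable M" using distributed_measurable[OF assms(2)] by simp
  have "density lborel std_normal_density = distr M lborel Z"
    using assms(2) by (simp add: distributed_def)
  then have "measure (density lborel std_normal_density) A = measure M (Z -` A \<inter> space M)"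
    using assms(3) by (simp add: measure_distr)
  also have "Z -` A \<inter> space M = {\<omega> \<in> space M. Z \<omega> \<in> A}" by auto
  finally show ?thesis ..
qed

lemma gauss_tail_minus: "gauss_tail (- y) = 1 - gauss_tail y"
proof -
  let ?N = "density lborel std_normal_density"
  have "distributed ?N lborel (\<lambda>x. x) std_normal_density"
    unfolding distributed_def by (auto intro!: distr_id2[symmetric] simp: distr_id2)
  from std_normal.normal_density_affine[OF this, of "-1" 0]
  have "distributed ?N lborel (\<lambda>x. - x) std_normal_density" by simp
  from std_normal_distr[OF std_normal.prob_space_axioms this, of "{-y..}"]
  have "gauss_tail (- y) = measure ?N {..y}" by (simp add: gauss_tail_def atMost_def)
  also have "{..y} = {..<y} \<union> {y}" by auto
  also have "measure ?N \<dots> = measure ?N {..<y}"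
    by (subst std_normal.finite_measure_Union) (auto simp: std_normal_singleton)
  also have "{..<y} = space ?N - {y..}" by auto
  also have "measure ?N \<dots> = 1 - gauss_tail y"
    unfolding gauss_tail_def by (rule std_normal.prob_compl) simp
  finally show ?thesis .
qed

lemma gauss_tail_diff:
  assumes "a \<le> b"
  shows "gauss_tail a - gauss_tail b = integral {a..b} std_normal_density"
proof -
  let ?N = "density lborel std_normal_density"
  have si: "set_integrable lborel {a..b} std_normal_density"
    unfolding set_integrable_def by (intro integrable_mult_indicator integrable_normal_density) auto
  have "{a..} = {a..<b} \<union> {b..}" using assms by auto
  then have "gauss_tail a = measure ?N {a..<b} + gauss_tail b"
    unfolding gauss_tail_def by (simp, subst std_normal.finite_measure_Union) auto
  moreover have "measure ?N {a..b} = measure ?N {a..<b}"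
  proof -
    have "{a..b} = {a..<b} \<union> {b}" using assms by auto
    moreover have "measure ?N ({a..<b} \<union> {b}) = measure ?N {a..<b}"
      by (subst std_normal.finite_measure_Union) (auto simp: std_normal_singleton)
    ultimately show ?thesis by simp
  qed
  moreover have "measure ?N {a..b} = (LINT x:{a..b}|lborel. std_normal_density x)"
  proof -
    have "emeasure ?N {a..b} = (\<integral>\<^sup>+x. ennreal (indicator {a..b} x * std_normal_density x) \<partial>lborel)"
      by (subst emeasure_density) (auto intro!: nn_integral_cong split: split_indicator)
    also have "\<dots> = ennreal (LINT x:{a..b}|lborel. std_normal_density x)"
      using si unfolding set_integrable_def set_lebesgue_integral_def
      by (subst nn_integral_eq_integral) auto
    finally show ?thesis
      by (simp add: measure_def set_lebesgue_integral_def integral_nonneg_AE)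
  qed
  ultimately show ?thesis using set_borel_integral_eq_integral(2)[OF si] by simp
qed

lemma DERIV_gauss_tail: "(gauss_tail has_real_derivative - std_normal_density y) (at y)"
proof -
  have cont: "continuous_on {y-1..y+1} std_normal_density"
    unfolding normal_density_def by (intro continuous_intros) auto
  have "((\<lambda>x. gauss_tail (y - 1) - integral {y-1..x} std_normal_density) has_real_derivative
      0 - std_normal_density y) (at y within {y-1..y+1})"
    by (intro DERIV_diff DERIV_const integral_has_real_derivative[OF cont]) auto
  then have "(gauss_tail has_real_derivative - std_normal_density y) (at y within {y-1..y+1})"
    unfolding diff_0
    by (rule has_field_derivative_transform_within[where d = 1])
       (auto simp: gauss_tail_diff[symmetric])
  then show ?thesis by (simp add: at_within_Icc_at)
qed

text \<open>Gives the limit of \<open>n + 1\<close> equal losses, one for each slice of the Brownian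
  maximum. The sign of \<open>s\<close> is free because the estimates from above and from below
  approach \<open>r\<close> from opposite sides.\<close>

lemma gauss_tail_difference_quotient:
  assumes "s \<noteq> 0"
  shows "(\<lambda>n. real (Suc n) * (gauss_tail r - gauss_tail (r + 2 * (s / real (Suc n)))))
    \<longlonglongrightarrow> 2 * s * std_normal_density r"
proof -
  define h where "h n = 2 * (s / real (Suc n))" for n
  have "((\<lambda>h. (gauss_tail (r + h) - gauss_tail r) / h) \<longlongrightarrow> - std_normal_density r) (at 0)"
    using DERIV_gauss_tail[of r] by (simp add: DERIV_def)
  moreover have "filterlim h (at 0) sequentially"
  proof (rule filterlim_atI)
    have "(\<lambda>n. (2 * s) * inverse (real (Suc n))) \<longlonglongrightarrow> (2 * s) * 0"
      by (intro tendsto_mult tendsto_const LIMSEQ_inverse_real_of_nat)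
    then show "h \<longlonglongrightarrow> 0" by (simp add: h_def[abs_def] divide_inverse mult.assoc)
    show "\<forall>\<^sub>F n in sequentially. h n \<noteq> 0" using assms by (simp add: h_def)
  qed
  ultimately have "(\<lambda>n. (gauss_tail (r + h n) - gauss_tail r) / h n) \<longlonglongrightarrow> - std_normal_density r"
    by (rule filterlim_compose)
  then have "(\<lambda>n. - 2 * s * ((gauss_tail (r + h n) - gauss_tail r) / h n))
    \<longlonglongrightarrow> - 2 * s * - std_normal_density r"
    by (intro tendsto_mult tendsto_const)
  moreover have "- 2 * s * ((gauss_tail (r + h n) - gauss_tail r) / h n)
    = real (Suc n) * (gauss_tail r - gauss_tail (r + h n))" for n
    using assms by (simp add: h_def field_simps)
  ultimately show ?thesis unfolding h_def by simp
qed

lemma DERIV_std_normal_density: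
  "(std_normal_density has_real_derivative - y * std_normal_density y) (at y)"
  unfolding std_normal_density_def by (auto intro!: derivative_eq_intros simp: field_simps)

text \<open>The tail of the chi distribution with three degrees of freedom, the law at time one of the
  three-dimensional Bessel process \<open>2 * max B - B\<close> of Pitman's theorem.\<close>
definition bessel_tail :: "real \<Rightarrow> real" where
  "bessel_tail y = 2 * gauss_tail y + 2 * y * std_normal_density y"

lemma DERIV_bessel_tail:
  "(bessel_tail has_real_derivative - 2 * y\<^sup>2 * std_normal_density y) (at y)"
  unfolding bessel_tail_def[abs_def]
  by (auto intro!: derivative_eq_intros DERIV_gauss_tail DERIV_std_normal_density simp:
    power2_eq_square)

lemma bessel_tail_0: "bessel_tail 0 = 1"
  using gauss_tail_minus[of 0] by (simp add: bessel_tail_def)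

lemma bessel_tail_nonneg: "0 \<le> y \<Longrightarrow> 0 \<le> bessel_tail y"
  unfolding bessel_tail_def using gauss_tail_nonneg[of y] by simp

lemma bessel_tail_antimono: "a \<le> b \<Longrightarrow> bessel_tail b \<le> bessel_tail a"
  by (rule DERIV_nonpos_imp_nonincreasing[of a b bessel_tail])
     (auto intro!: exI DERIV_bessel_tail mult_nonneg_nonneg)

lemma std_normal_density_le: "2 * std_normal_density y \<le> exp (- y\<^sup>2 / 2)"
proof -
  have "2 \<le> sqrt (2 * pi)" using pi_gt3 by (intro real_le_rsqrt) auto
  then have "2 / sqrt (2 * pi) * exp (- y\<^sup>2 / 2) \<le> 1 * exp (- y\<^sup>2 / 2)"
    by (intro mult_right_mono) auto
  then show ?thesis by (simp add: std_normal_density_def)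
qed

text \<open>The density \<open>2 * y\<^sup>2 * std_normal_density y\<close> is at most 1. This pays
  for rounding the argument to the lattice.\<close>

lemma bessel_tail_lipschitz: "\<bar>bessel_tail a - bessel_tail b\<bar> \<le> \<bar>a - b\<bar>"
proof -
  have le: "2 * y\<^sup>2 * std_normal_density y \<le> 1" for y
  proof -
    \<comment> \<open>The difference of the sides is
      \<open>((y\<^sup>2 / 2 - 1)\<^sup>2 + 1) / 2\<close>.\<close>
    have "y\<^sup>2 \<le> 1 + (y\<^sup>2 / 2) + (y\<^sup>2 / 2)\<^sup>2 / 2"
      using zero_le_power2[of "y\<^sup>2 / 2 - 1"] by (simp add: power2_eq_square algebra_simps)
    also have "\<dots> \<le> exp (y\<^sup>2 / 2)" by (rule exp_lower_Taylor_quadratic) simp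
    finally have "y\<^sup>2 * exp (- y\<^sup>2 / 2) \<le> 1" by (simp add: exp_minus field_simps)
    moreover have "y\<^sup>2 * (2 * std_normal_density y) \<le> y\<^sup>2 * exp (- y\<^sup>2 / 2)"
      by (intro mult_left_mono std_normal_density_le) simp
    ultimately show ?thesis by simp
  qed
  have *: "bessel_tail a - bessel_tail b \<le> b - a" if "a \<le> b" for a b
  proof -
    have "bessel_tail a + a \<le> bessel_tail b + b"
      by (rule DERIV_nonneg_imp_nondecreasing[OF that, of "\<lambda>x. bessel_tail x + x"])
         (auto intro!: exI DERIV_add DERIV_bessel_tail DERIV_ident simp: le)
    then show ?thesis by simp
  qed
  show ?thesis using *[of a b] *[of b a] bessel_tail_antimono[of a b] bessel_tail_antimono[of b a]
    by linarith
qed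

text \<open>On a logarithmic scale the density is \<open>2 * y ^ 3 * std_normal_density y\<close>,
  at most 2. A change of variance then costs an amount independent of \<open>y\<close>, where the
  plain Lipschitz bound would grow with \<open>y\<close>.\<close>

lemma bessel_tail_scale:
  assumes "0 < a" "a \<le> b"
  shows "bessel_tail a - bessel_tail b \<le> 2 * (ln b - ln a)"
proof -
  have le: "y ^ 3 * std_normal_density y \<le> 1" if "0 < y" for y
  proof -
    \<comment> \<open>The difference of the sides is 2 plus the square of
      \<open>y * (y / 2 - 1)\<close>.\<close>
    have "y ^ 3 \<le> 2 * (1 + (y\<^sup>2 / 2) + (y\<^sup>2 / 2)\<^sup>2 / 2)"
      using zero_le_power2[of "y * (y / 2 - 1)"]
      by (simp add: power2_eq_square power3_eq_cube algebra_simps) 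
    also have "\<dots> \<le> 2 * exp (y\<^sup>2 / 2)" by (intro mult_left_mono exp_lower_Taylor_quadratic) auto
    finally have "y ^ 3 * exp (- y\<^sup>2 / 2) \<le> 2" by (simp add: exp_minus field_simps)
    moreover have "y ^ 3 * (2 * std_normal_density y) \<le> y ^ 3 * exp (- y\<^sup>2 / 2)"
      using that by (intro mult_left_mono std_normal_density_le) simp
    ultimately show ?thesis by simp
  qed
  have "bessel_tail a + 2 * ln a \<le> bessel_tail b + 2 * ln b"
  proof (rule DERIV_nonneg_imp_nondecreasing[OF assms(2), of "\<lambda>x. bessel_tail x + 2 * ln x"])
    fix x assume "a \<le> x" "x \<le> b"
    then have x: "x > 0" using assms by simp
    show "\<exists>y. ((\<lambda>x. bessel_tail x + 2 * ln x) has_real_derivative y) (at x) \<and> 0 \<le> y"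
      using x le[OF x]
      by (intro exI[of _ "- 2 * x\<^sup>2 * std_normal_density x + 2 * (1 / x)"] conjI)
         (auto intro!: derivative_eq_intros DERIV_bessel_tail simp: field_simps power2_eq_square
           power3_eq_cube)
  qed
  then show ?thesis by simp
qed

section \<open>Lattice sums against integrals\<close>

definition bessel_weight :: "real \<Rightarrow> real \<Rightarrow> real" where
  "bessel_weight v z = z\<^sup>2 * exp (- z\<^sup>2 / (2 * v))"

text \<open>The integral of \<open>bessel_weight v\<close> over the half-line from \<open>z\<close>,
  in closed form after scaling by \<open>sqrt v\<close>.\<close>

definition bessel_int :: "real \<Rightarrow> real \<Rightarrow> real" where
  "bessel_int v z = v * sqrt v * sqrt (pi / 2) * bessel_tail (z / sqrt v)"

text \<open>A majorant for the total variation of \<open>bessel_weight v\<close> on the half-line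
  from \<open>z \<ge> 0\<close>. The summand \<open>4 * v\<close> makes the linear terms cancel in
  the derivative of \<open>bessel_weight v z + bessel_var v z\<close>.\<close>

definition bessel_var :: "real \<Rightarrow> real \<Rightarrow> real" where
  "bessel_var v z = (z\<^sup>2 + 4 * v) * exp (- z\<^sup>2 / (2 * v))"

lemma DERIV_bessel_int:
  assumes "0 < v"
  shows "(bessel_int v has_real_derivative - bessel_weight v z) (at z)"
proof -
  have "((\<lambda>z. bessel_tail (z / sqrt v)) has_real_derivative
      - 2 * (z / sqrt v)\<^sup>2 * std_normal_density (z / sqrt v) * (1 / sqrt v)) (at z)"
    using assms by (intro DERIV_chain2[OF DERIV_bessel_tail] DERIV_cdivide DERIV_ident)
  then have "(bessel_int v has_real_derivative
      v * sqrt v * sqrt (pi / 2) * (- 2 * (z / sqrt v)\<^sup>2 * std_normal_density (z / sqrt v)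
        * (1 / sqrt v))) (at z)"
    unfolding bessel_int_def[abs_def] by (rule DERIV_cmult)
  moreover have "v * sqrt v * sqrt (pi / 2) * (- 2 * (z / sqrt v)\<^sup>2
    * std_normal_density (z / sqrt v) * (1 / sqrt v))
    = - bessel_weight v z"
  proof -
    have "2 * sqrt (pi / 2) / sqrt (2 * pi) = 1"
      by (simp add: real_sqrt_divide real_sqrt_mult field_simps)
    then have "2 * sqrt (pi / 2) * std_normal_density (z / sqrt v) = exp (- z\<^sup>2 / (2 * v))"
      using assms by (simp add: std_normal_density_def power_divide)
    then show ?thesis using assms unfolding bessel_weight_def
      by (simp add: power_divide field_simps)
  qed
  ultimately show ?thesis by simp
qed

text \<open>Both \<open>bessel_var v - bessel_weight v\<close> and
  \<open>bessel_var v + bessel_weight v\<close> decrease on the positive axis: the former is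
  \<open>4 * v\<close> times a Gaussian, the latter has derivative \<open>- (2 * z ^ 3 / v)\<close>
  times a Gaussian.\<close>

lemma bessel_var_dominates:
  assumes "0 < v" "0 \<le> a" "a \<le> b"
  shows "\<bar>bessel_weight v a - bessel_weight v b\<bar> \<le> bessel_var v a - bessel_var v b"
proof -
  have "a\<^sup>2 \<le> b\<^sup>2" using assms by (simp add: power_mono)
  then have "exp (- b\<^sup>2 / (2 * v)) \<le> exp (- a\<^sup>2 / (2 * v))" using assms
    by (simp add: divide_right_mono)
  then have "bessel_var v b - bessel_weight v b \<le> bessel_var v a - bessel_weight v a"
    using assms by (simp add: bessel_var_def bessel_weight_def algebra_simps)
  moreover have "bessel_weight v b + bessel_var v b \<le> bessel_weight v a + bessel_var v a"
  proof (rule DERIV_nonpos_imp_nonincreasing[OF assms(3), of "\<lambda>z. bessel_weight v z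
    + bessel_var v z"])
    fix x assume "a \<le> x" "x \<le> b"
    then have "0 \<le> x" using assms by simp
    then show "\<exists>y. ((\<lambda>z. bessel_weight v z + bessel_var v z) has_real_derivative y) (at x) \<and> y \<le> 0"
      unfolding bessel_weight_def bessel_var_def using assms
      by (intro exI[of _ "- (2 * x ^ 3 / v) * exp (- x\<^sup>2 / (2 * v))"] conjI)
         (auto intro!: derivative_eq_intros simp: field_simps power2_eq_square power3_eq_cube)
  qed
  ultimately show ?thesis by linarith
qed

lemma bessel_var_antimono: "0 < v \<Longrightarrow> 0 \<le> a \<Longrightarrow> a \<le> b \<Longrightarrow> bessel_var v b \<le> bessel_var v a"
  using bessel_var_dominates[of v a b] by linarith

lemma bessel_var_nonneg: "0 < v \<Longrightarrow> 0 \<le> bessel_var v z"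
  by (simp add: bessel_var_def)

lemma bessel_var_le: "0 < v \<Longrightarrow> 0 \<le> z \<Longrightarrow> bessel_var v z \<le> 4 * v"
  using bessel_var_antimono[of v 0 z] by (simp add: bessel_var_def)

text \<open>Cells have length 2 because of parity. By the mean value theorem the integral over a
  cell is twice the weight at an inner point, and a decrement of \<open>bessel_var\<close> covers
  the distance to the weight at \<open>j\<close>, so that the error telescopes too.\<close>

lemma bessel_riemann_step:
  assumes "0 < v" "0 \<le> j"
  shows "2 * bessel_weight v j
    \<le> (bessel_int v j + 2 * bessel_var v j) - (bessel_int v (j + 2) + 2 * bessel_var v (j + 2))"
proof -
  obtain z where z: "j < z" "z < j + 2" "bessel_int v (j + 2) - bessel_int v j
    = (j + 2 - j) * (- bessel_weight v z)"
    using MVT2[of j "j + 2" "bessel_int v" "\<lambda>z.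
      - bessel_weight v z"] DERIV_bessel_int[OF assms(1)] by auto
  have "bessel_weight v j \<le> bessel_weight v z + (bessel_var v j - bessel_var v z)"
    using bessel_var_dominates[of v j z] z assms by linarith
  moreover have "bessel_var v (j + 2) \<le> bessel_var v z"
    using z assms by (intro bessel_var_antimono) auto
  ultimately show ?thesis using z(3) by simp
qed

section \<open>The simple walk\<close>

locale simple_walk = symmetric_walk +
  assumes sign: "\<And>i \<omega>. \<omega> \<in> space M \<Longrightarrow> i < m \<Longrightarrow> \<xi> i \<omega> = 1 \<or> \<xi> i \<omega> = - 1"
    and half: "\<And>i. i < m \<Longrightarrow> prob {\<omega> \<in> space M. \<xi> i \<omega> = 1} = 1 / 2"
begin

lemma prob_down: "i < m \<Longrightarrow> prob {\<omega> \<in> space M. \<xi> i \<omega> = - 1} = 1 / 2"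
proof -
  assume i: "i < m"
  have [measurable]: "\<xi> i \<in> borel_measurable M" using i by simp
  have "prob (space M - {\<omega> \<in> space M. \<xi> i \<omega> = 1}) = 1 - 1 / 2"
    using half[OF i] by (subst prob_compl) auto
  moreover have "space M - {\<omega> \<in> space M. \<xi> i \<omega> = 1} = {\<omega> \<in> space M. \<xi> i \<omega> = - 1}"
    using sign[OF _ i] by fastforce
  ultimately show ?thesis by simp
qed

text \<open>\<open>i\<close> counts the down steps; this records range and parity of the
  walk.\<close>

lemma S_int: "\<omega> \<in> space M \<Longrightarrow> k \<le> m \<Longrightarrow> \<exists>i\<le>k. S k \<omega> = real k - 2 * real i"
proof (induction k)
  case (Suc k)
  then obtain i where i: "i \<le> k" "S k \<omega> = real k - 2 * real i" by auto
  from sign[of \<omega> k] Suc.prems have "\<xi> k \<omega> = 1 \<or> \<xi> k \<omega> = - 1" by auto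
  then show ?case
  proof
    assume "\<xi> k \<omega> = 1"
    then show ?case using i by (intro exI[of _ i]) (simp add: S_def)
  next
    assume "\<xi> k \<omega> = - 1"
    then show ?case using i by (intro exI[of _ "Suc i"]) (simp add: S_def)
  qed
qed (simp add: S_def)

lemma S_le: "\<omega> \<in> space M \<Longrightarrow> k \<le> m \<Longrightarrow> S k \<omega> \<le> real k"
  using S_int[of \<omega> k] by auto

text \<open>The last step is independent of the walk before it, and splitting by it gives Pascal's
  rule.\<close>

lemma prob_S: "k \<le> m \<Longrightarrow> prob {\<omega> \<in> space M. S k \<omega> = real k - 2 * real i} = real (k choose i) / 2 ^ k"
proof (induction k arbitrary: i)
  case 0
  then show ?case by (cases i) (auto simp: S_def prob_space)
next
  case (Suc k)
  then have k: "k < m" by simp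
  have [measurable]: "\<xi> k \<in> borel_measurable M" "S k \<in> borel_measurable M" using k by auto
  have "indep_var borel (\<xi> k) borel (\<lambda>\<omega>. \<Sum>i\<in>{..<k}. \<xi> i \<omega>)"
    by (rule indep_vars_sum) (use k in \<open>auto intro!: indep_vars_subset[OF indep]\<close>)
  then have ind: "indep_var borel (\<xi> k) borel (S k)" unfolding S_def[abs_def] .
  have prod: "prob {\<omega> \<in> space M. \<xi> k \<omega> = a \<and> S k \<omega> = b} = prob {\<omega> \<in> space M. \<xi> k \<omega>
    = a} * prob {\<omega> \<in> space M. S k \<omega> = b}"
    for a b
  proof -
    have "prob ((\<lambda>x. (\<xi> k x, S k x)) -` ({a} \<times> {b}) \<inter> space M)
      = prob (\<xi> k -` {a} \<inter> space M) * prob (S k -` {b} \<inter> space M)"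
      by (rule indep_varD[OF ind]) auto
    then show ?thesis by (simp add: vimage_def Int_def conj_commute)
  qed
  have split: "{\<omega> \<in> space M. S (Suc k) \<omega> = c} = {\<omega> \<in> space M. \<xi> k \<omega> = 1 \<and> S k \<omega> = c - 1}
    \<union> {\<omega> \<in> space M. \<xi> k \<omega> = - 1 \<and> S k \<omega> = c + 1}" for c
    using sign[OF _ k] by (fastforce simp: S_def)
  have rec: "prob {\<omega> \<in> space M. S (Suc k) \<omega> = c} = (prob {\<omega> \<in> space M. S k \<omega>
    = c - 1} + prob {\<omega> \<in> space M. S k \<omega> = c + 1}) / 2" for c
    unfolding split
    by (subst finite_measure_Union) (auto simp: prod half[OF k] prob_down[OF k])
  have eq: "real (Suc k) - 2 * real i - 1 = real k - 2 * real i" by simp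
  show ?case
  proof (cases i)
    case 0
    have "prob {\<omega> \<in> space M. S k \<omega> = real k + 2} = 0"
    proof -
      have "{\<omega> \<in> space M. S k \<omega> = real k + 2} = {}" using S_le[of _ k] k by fastforce
      then show ?thesis by (simp only: measure_empty)
    qed
    then show ?thesis unfolding rec eq using Suc.IH[of 0] Suc.prems 0 by (simp add: add_ac)
  next
    case i: (Suc j)
    have "real (Suc k) - 2 * real i + 1 = real k - 2 * real j" using i by simp
    then show ?thesis unfolding rec eq using Suc.IH[of i] Suc.IH[of j] Suc.prems i
      by (simp add: add_divide_distrib)
  qed
qed

text \<open>Unit steps cannot jump over an integer level, and at time 0 the walk cannot exceed a
  level in the naturals.\<close>

lemma first_passage_value:
  assumes "\<omega> \<in> space M" "k \<le> m" "first_passage (real a) k \<omega>"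
  shows "S k \<omega> = real a"
proof (cases k)
  case 0
  then show ?thesis using assms by (simp add: first_passage_def S_def)
next
  case (Suc l)
  have "S l \<omega> < real a" "real a \<le> S k \<omega>" using assms Suc by (auto simp: first_passage_def)
  moreover obtain i where "S l \<omega> = real l - 2 * real i" using S_int[of \<omega> l] assms Suc by auto
  then have "S l \<omega> = of_int (int l - 2 * int i)" by simp
  moreover have "S k \<omega> = S l \<omega> + \<xi> l \<omega>" using Suc by (simp add: S_def)
  moreover have "\<xi> l \<omega> = 1 \<or> \<xi> l \<omega> = - 1" using assms Suc by (intro sign) auto
  moreover have "real a = of_int (int a)" by simp
  ultimately show ?thesis by (smt (verit) of_int_less_iff of_int_1 of_int_add of_int_le_iff)
qed

section \<open>Joint law of the peak and the end point\<close>

definition peak :: "'a \<Rightarrow> real" where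
  "peak \<omega> = Max ((\<lambda>k. S k \<omega>) ` {..m})"

lemma peak_ge_iff: "a \<le> peak \<omega> \<longleftrightarrow> (\<exists>k\<le>m. a \<le> S k \<omega>)"
  unfolding peak_def by (subst Max_ge_iff) auto

lemma peak_nat: "\<omega> \<in> space M \<Longrightarrow> \<exists>a. peak \<omega> = real a"
proof -
  assume \<omega>: "\<omega> \<in> space M"
  have "peak \<omega> \<in> (\<lambda>k. S k \<omega>) ` {..m}" unfolding peak_def by (intro Max_in) auto
  then obtain k where k: "k \<le> m" "peak \<omega> = S k \<omega>" by auto
  have "0 \<le> peak \<omega>" unfolding peak_ge_iff by (intro exI[of _ 0]) (simp add: S_def)
  moreover obtain i where "S k \<omega> = real k - 2 * real i" using S_int[OF \<omega> k(1)] by auto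
  ultimately have "peak \<omega> = real (k - 2 * i)" using k by auto
  then show ?thesis by blast
qed

lemma measurable_peak [measurable]: "peak \<in> borel_measurable M"
  unfolding peak_def[abs_def] by (intro borel_measurable_Max) auto

lemma prob_peak_S:
  assumes "b \<le> real a"
  shows "prob {\<omega> \<in> space M. real a \<le> peak \<omega> \<and> S m \<omega> = b} = prob {\<omega> \<in> space M. S m \<omega>
    = 2 * real a - b}"
proof -
  have "prob {\<omega> \<in> space M. (\<exists>k\<le>m. real a \<le> S k \<omega>) \<and> S m \<omega> \<in> {b}}
       = prob {\<omega> \<in> space M. 2 * real a - S m \<omega> \<in> {b}}"
    by (rule hitting_reflection) (use assms first_passage_value in auto)
  also have "{\<omega> \<in> space M. 2 * real a - S m \<omega> \<in> {b}} = {\<omega> \<in> space M. S m \<omega> = 2 * real a - b}"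
    by auto
  finally show ?thesis by (simp add: peak_ge_iff)
qed

text \<open>A discrete form of Pitman's theorem. On peak \<open>a\<close> the end point must be
  \<open>2 * a - r\<close>; reflecting at \<open>a\<close> and at \<open>a + 1\<close> gives a mass
  that does not depend on \<open>a\<close>, and \<open>a\<close> runs through the
  \<open>r + 1\<close> values from 0 to \<open>r\<close>.\<close>

lemma prob_pitman:
  fixes r :: nat
  shows "prob {\<omega> \<in> space M. 2 * peak \<omega> - S m \<omega> = real r}
    = (real r + 1) * (prob {\<omega> \<in> space M. S m \<omega> = real r} - prob {\<omega> \<in> space M. S m \<omega> = real r + 2})"
proof -
  have [measurable]: "S m \<in> borel_measurable M" by simp
  have "{\<omega> \<in> space M. 2 * peak \<omega> - S m \<omega> = real r}
     = (\<Union>a\<in>{..r}. {\<omega> \<in> space M. peak \<omega> = real a \<and> S m \<omega> = 2 * real a - real r})"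
  proof (intro equalityI subsetI)
    fix \<omega> assume \<omega>: "\<omega> \<in> {\<omega> \<in> space M. 2 * peak \<omega> - S m \<omega> = real r}"
    then obtain a where a: "peak \<omega> = real a" using peak_nat by auto
    \<comment> \<open>Because \<open>S m = 2 * a - r\<close>, this bounds \<open>a\<close> by
      \<open>r\<close>.\<close>
    have "S m \<omega> \<le> peak \<omega>" using peak_ge_iff[of "S m \<omega>" \<omega>] by auto
    then have "a \<le> r" using a \<omega> by auto
    then show "\<omega> \<in> (\<Union>a\<in>{..r}. {\<omega> \<in> space M. peak \<omega> = real a \<and> S m \<omega> = 2 * real a - real r})"
      using a \<omega> by auto
  qed auto
  then have "prob {\<omega> \<in> space M. 2 * peak \<omega> - S m \<omega> = real r}
     = (\<Sum>a\<le>r. prob {\<omega> \<in> space M. peak \<omega> = real a \<and> S m \<omega> = 2 * real a - real r})"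
    by (simp, intro finite_measure_finite_Union) (auto simp: disjoint_family_on_def)
  also have "\<dots> = (\<Sum>a\<le>r. prob {\<omega> \<in> space M. S m \<omega> = real r} - prob {\<omega> \<in> space M. S m \<omega>
    = real r + 2})"
  proof (intro sum.cong refl)
    fix a assume "a \<in> {..r}"
    then have a: "a \<le> r" by simp
    let ?b = "2 * real a - real r"
    have eq: "{\<omega> \<in> space M. peak \<omega> = real a \<and> S m \<omega> = ?b}
      = {\<omega> \<in> space M. real a \<le> peak \<omega> \<and> S m \<omega> = ?b} - {\<omega> \<in> space M. real (Suc a) \<le> peak \<omega> \<and> S m \<omega>
        = ?b}"
    proof (intro equalityI subsetI)
      fix \<omega> assume *: "\<omega> \<in> {\<omega> \<in> space M. real a \<le> peak \<omega> \<and> S m \<omega>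
        = ?b} - {\<omega> \<in> space M. real (Suc a) \<le> peak \<omega> \<and> S m \<omega> = ?b}"
      then obtain b where "peak \<omega> = real b" using peak_nat by blast
      with * have "real a \<le> real b" "\<not> real (Suc a) \<le> real b" by auto
      then have "b = a" by linarith
      with * \<open>peak \<omega> = real b\<close> show "\<omega> \<in> {\<omega> \<in> space M. peak \<omega> = real a \<and> S m \<omega> = ?b}" by simp
    qed auto
    have diff: "prob {\<omega> \<in> space M. peak \<omega> = real a \<and> S m \<omega> = ?b}
      = prob {\<omega> \<in> space M. real a \<le> peak \<omega> \<and> S m \<omega> = ?b}
      - prob {\<omega> \<in> space M. real (Suc a) \<le> peak \<omega> \<and> S m \<omega> = ?b}"
      unfolding eq
    proof (rule finite_measure_Diff)
      show "{\<omega> \<in> space M. real a \<le> peak \<omega> \<and> S m \<omega> = ?b} \<in> sets M" by measurable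
      show "{\<omega> \<in> space M. real (Suc a) \<le> peak \<omega> \<and> S m \<omega> = ?b} \<in> sets M" by measurable
      show "{\<omega> \<in> space M. real (Suc a) \<le> peak \<omega> \<and> S m \<omega> = ?b}
        \<subseteq> {\<omega> \<in> space M. real a \<le> peak \<omega> \<and> S m \<omega> = ?b}"
        by (intro Collect_mono impI conjI) linarith+
    qed
    have p0: "prob {\<omega> \<in> space M. real a \<le> peak \<omega> \<and> S m \<omega> = ?b} = prob {\<omega> \<in> space M. S m \<omega> = real r}"
    proof -
      have eq: "2 * real a - ?b = real r" by linarith
      have "?b \<le> real a" using a by simp
      from prob_peak_S[OF this] show ?thesis unfolding eq .
    qed
    have p1: "prob {\<omega> \<in> space M. real (Suc a) \<le> peak \<omega> \<and> S m \<omega> = ?b} = prob {\<omega> \<in> space M. S m \<omega>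
      = real r + 2}"
    proof -
      have eq: "2 * real (Suc a) - ?b = real r + 2" by (simp add: algebra_simps)
      have "?b \<le> real (Suc a)" using a by linarith
      from prob_peak_S[OF this] show ?thesis unfolding eq .
    qed
    show "prob {\<omega> \<in> space M. peak \<omega> = real a \<and> S m \<omega> = ?b} =
      prob {\<omega> \<in> space M. S m \<omega> = real r} - prob {\<omega> \<in> space M. S m \<omega> = real r + 2}"
      unfolding diff p0 p1 ..
  qed
  also have "\<dots> = (real r + 1) * (prob {\<omega> \<in> space M. S m \<omega> = real r} - prob {\<omega> \<in> space M. S m \<omega>
    = real r + 2})"
    unfolding sum_constant card_atMost of_nat_Suc by (simp only: add.commute)
  finally show ?thesis .
qed

text \<open>So \<open>2 * peak - S + 1\<close> has the law of the absolute value of a simple walk with one more step,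
  biased by its square.\<close>
lemma prob_pitman_binomial:
  assumes "2 * i \<le> m"
  shows "prob {\<omega> \<in> space M. 2 * peak \<omega> - S m \<omega> = real m - 2 * real i}
    = 2 * (real (Suc m) - 2 * real i)\<^sup>2 / real (Suc m) * (real (Suc m choose i) / 2 ^ Suc m)"
proof -
  have r: "real m - 2 * real i = real (m - 2 * i)" using assms by simp
  have p: "prob {\<omega> \<in> space M. S m \<omega> = real (m - 2 * i)} = real (m choose i) / 2 ^ m"
    using prob_S[of m i] unfolding r by simp
  have L: "prob {\<omega> \<in> space M. 2 * peak \<omega> - S m \<omega> = real m - 2 * real i}
    = (real m - 2 * real i + 1) * (real (m choose i) / 2 ^ m - prob {\<omega> \<in> space M. S m \<omega>
      = real (m - 2 * i) + 2})"
    using prob_pitman[of "m - 2 * i", unfolded p] unfolding r .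
  show ?thesis
  proof (cases i)
    case 0
    have "{\<omega> \<in> space M. S m \<omega> = real (m - 2 * i) + 2} = {}" 
      unfolding 0 using S_le[OF _ order_refl] by fastforce
    then have "prob {\<omega> \<in> space M. S m \<omega> = real (m - 2 * i) + 2} = 0" by (simp only: measure_empty)
    then show ?thesis unfolding L using 0 by (simp add: power2_eq_square) (simp add: field_simps)
  next
    case (Suc j)
    have "real (m - 2 * i) + 2 = real m - 2 * real j" using Suc assms by (simp add: of_nat_diff)
    then have p2: "prob {\<omega> \<in> space M. S m \<omega> = real (m - 2 * i) + 2} = real (m choose j) / 2 ^ m"
      using prob_S[of m j] by simp
    have "Suc j * (Suc m choose Suc j) = Suc m * (m choose j)"
      by (metis Suc_times_binomial_eq mult.commute)
    then have e1: "real i * real (Suc m choose i) = real (Suc m) * real (m choose j)"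
      using Suc by (metis of_nat_mult)
    have e2: "real (Suc m choose i) = real (m choose j) + real (m choose i)"
      unfolding Suc binomial_Suc_Suc by (rule of_nat_add)
    \<comment> \<open>A ballot identity: Pascal's rule and absorption express the difference of
      neighbouring coefficients by a single coefficient of order \<open>m + 1\<close>.\<close>
    have "real (Suc m) * (real (m choose i) - real (m choose j))
      = (real (Suc m) - 2 * real i) * real (Suc m choose i)"
      using e1 e2 by (simp add: algebra_simps)
    then have "real (m choose i) - real (m choose j)
      = (real (Suc m) - 2 * real i) * real (Suc m choose i) / real (Suc m)"
      by (simp add: field_simps del: of_nat_Suc binomial_Suc_Suc)
    moreover have "real (m choose i) / 2 ^ m - real (m choose j) / 2 ^ m
      = (real (m choose i) - real (m choose j)) / 2 ^ m"
      by (simp add: diff_divide_distrib)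
    ultimately show ?thesis unfolding L p2 by (simp add: power2_eq_square del: binomial_Suc_Suc)
  qed
qed

text \<open>The peak is reached at some time \<open>k\<close>, is at most \<open>k\<close>, and is
  followed by a descent of at most \<open>m - k\<close>; so the value is at most \<open>m\<close>.
  It is nonnegative because the peak dominates both 0 and \<open>S m\<close>, and its parity is that
  of \<open>m\<close>.\<close>

lemma pitman_support:
  assumes \<omega>: "\<omega> \<in> space M"
  shows "\<exists>i. 2 * i \<le> m \<and> 2 * peak \<omega> - S m \<omega> = real m - 2 * real i"
proof -
  have "peak \<omega> \<in> (\<lambda>k. S k \<omega>) ` {..m}" unfolding peak_def by (intro Max_in) auto
  then obtain k where k: "k \<le> m" "peak \<omega> = S k \<omega>" by auto
  have drop: "S k \<omega> - real (j - k) \<le> S j \<omega>" if "k \<le> j" "j \<le> m" for j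
    using that
  proof (induction j rule: dec_induct)
    case (step j)
    have "- 1 \<le> \<xi> j \<omega>" using sign[OF \<omega>, of j] step by auto
    moreover have "S (Suc j) \<omega> = S j \<omega> + \<xi> j \<omega>" by (simp add: S_def)
    ultimately show ?case using step by (simp add: Suc_diff_le)
  qed simp
  have up: "2 * peak \<omega> - S m \<omega> \<le> real m"
    using drop[of m] S_le[OF \<omega> k(1)] k by (simp add: of_nat_diff)
  have "S m \<omega> \<le> peak \<omega>" "0 \<le> peak \<omega>"
    unfolding peak_ge_iff by (auto intro: exI[of _ 0] simp: S_def)
  then have low: "0 \<le> 2 * peak \<omega> - S m \<omega>" by linarith
  obtain a where a: "peak \<omega> = real a" using peak_nat[OF \<omega>] by blast
  obtain j where j: "S m \<omega> = real m - 2 * real j" using S_int[OF \<omega>, of m] by auto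
  have "a + j \<le> m" using up unfolding a j by linarith
  moreover have "m \<le> 2 * (a + j)"
  proof -
    have "real m \<le> 2 * real a + 2 * real j" using low unfolding a j by argo
    also have "\<dots> = real (2 * (a + j))" by simp
    finally show ?thesis by (simp only: of_nat_le_iff)
  qed
  ultimately show ?thesis unfolding a j by (intro exI[of _ "m - (a + j)"]) (auto simp: of_nat_diff)
qed

section \<open>Summing the bounds on the point masses\<close>

definition env :: real where
  "env = sqrt (2 / (pi * real (Suc m))) * exp (1 / (2 * (real m + 2))) / real (Suc m)"

text \<open>\<open>env\<close> times \<open>2 * bessel_weight\<close> bounds a point mass. With the
  variation term included, differences of \<open>majorant\<close> at distance 2 bound it as well, so
  that sums telescope.\<close>

definition majorant :: "real \<Rightarrow> real" where
  "majorant j = env * (bessel_int (real m + 2) j + 2 * bessel_var (real m + 2) j)"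

lemma env_nonneg: "0 \<le> env"
  unfolding env_def by simp

text \<open>With \<open>j = m + 1 - 2 * i\<close> the right side is
  \<open>majorant j - majorant (j + 2)\<close>. The argument \<open>j\<close> exceeds the value by
  1, since the mass is expressed through a walk with one more step.\<close>

lemma prob_pitman_le:
  assumes "2 * i \<le> m"
  shows "prob {\<omega> \<in> space M. 2 * peak \<omega> - S m \<omega> = real m - 2 * real i}
    \<le> majorant (real m + 3 - 2 * real (Suc i)) - majorant (real m + 3 - 2 * real i)"
proof -
  define L where "L = Suc m"
  define j where "j = real L - 2 * real i"
  have j: "0 \<le> j" using assms by (simp add: j_def L_def)
  have v: "real L + 1 = real m + 2" by (simp add: L_def)
  have "prob {\<omega> \<in> space M. 2 * peak \<omega> - S m \<omega> = real m - 2 * real i}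
    = 2 * j\<^sup>2 / real L * (real (L choose i) / 2 ^ L)"
    using prob_pitman_binomial[OF assms] by (simp only: L_def j_def)
  also have "\<dots> \<le> 2 * j\<^sup>2 / real L * (sqrt (2 / (pi * real L)) * exp (1 / (2 * (real L + 1)))
           * exp (- (real L - 2 * real i)\<^sup>2 / (2 * (real L + 1))))"
    using assms by (intro mult_left_mono binomial_gaussian_bound) (auto simp: L_def)
  also have "\<dots> = env * (2 * bessel_weight (real m + 2) j)"
    unfolding env_def bessel_weight_def v j_def[symmetric] by (simp add: L_def)
  also have "\<dots> \<le> env * ((bessel_int (real m + 2) j + 2 * bessel_var (real m + 2) j)
    - (bessel_int (real m + 2) (j + 2) + 2 * bessel_var (real m + 2) (j + 2)))"
    using j by (intro mult_left_mono bessel_riemann_step env_nonneg) auto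
  also have "\<dots> = majorant j - majorant (j + 2)"
    unfolding majorant_def by (simp add: algebra_simps)
  finally show ?thesis by (simp add: j_def L_def algebra_simps)
qed

lemma majorant_antimono:
  assumes "0 \<le> a" "a \<le> b"
  shows "majorant b \<le> majorant a"
proof -
  let ?v = "real m + 2"
  have "bessel_int ?v b \<le> bessel_int ?v a"
    unfolding bessel_int_def using assms by (intro mult_left_mono bessel_tail_antimono
      divide_right_mono) auto
  moreover have "bessel_var ?v b \<le> bessel_var ?v a"
    using assms by (intro bessel_var_antimono) auto
  ultimately show ?thesis unfolding majorant_def by (intro mult_left_mono env_nonneg) auto
qed

lemma majorant_nonneg: "0 \<le> j \<Longrightarrow> 0 \<le> majorant j"
  unfolding majorant_def bessel_int_def
  by (intro mult_nonneg_nonneg env_nonneg add_nonneg_nonneg bessel_tail_nonneg bessel_var_nonneg)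
    auto

text \<open>Only upper bounds on the point probabilities are available. Summing them over the values below
  \<open>t\<close> instead of above bounds the tail from below, because the total mass is one.\<close>
lemma pitman_sandwich:
  assumes t: "0 < t"
  defines "T \<equiv> prob {\<omega> \<in> space M. t \<le> 2 * peak \<omega> - S m \<omega>}"
  shows "\<exists>j. t + 1 \<le> j \<and> j \<le> t + 3 \<and> T \<le> majorant j \<and> 1 - T \<le> majorant 0 - majorant j"
proof -
  define q where "q i = prob {\<omega> \<in> space M. 2 * peak \<omega> - S m \<omega> = real m - 2 * real i}" for i
  define g where "g i = majorant (real m + 3 - 2 * real i)" for i
  define D where "D = Suc (m div 2)"
  have D: "i < D \<longleftrightarrow> 2 * i \<le> m" for i unfolding D_def by auto
  have [measurable]: "S m \<in> borel_measurable M" by simp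
  have sumq: "prob {\<omega> \<in> space M. \<exists>i\<in>I. 2 * peak \<omega> - S m \<omega> = real m - 2 * real i}
    = sum q I" if "finite I" for I
  proof -
    have "prob (\<Union>i\<in>I. {\<omega> \<in> space M. 2 * peak \<omega> - S m \<omega> = real m - 2 * real i}) = sum q I"
      unfolding q_def using that by (intro finite_measure_finite_Union) (auto simp:
        disjoint_family_on_def)
    moreover have "(\<Union>i\<in>I. {\<omega> \<in> space M. 2 * peak \<omega> - S m \<omega> = real m - 2 * real i})
      = {\<omega> \<in> space M. \<exists>i\<in>I. 2 * peak \<omega> - S m \<omega> = real m - 2 * real i}" by auto
    ultimately show ?thesis by simp
  qed
  \<comment> \<open>The values decrease in \<open>i\<close>, so exactly the indices below
    \<open>I\<close> belong to the tail at \<open>t\<close>.\<close>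
  define I where "I = (LEAST i. real m - 2 * real i < t)"
  have ex: "real m - 2 * real m < t" using t by linarith
  have I1: "real m - 2 * real I < t" unfolding I_def by (rule LeastI[of _ m]) (rule ex)
  have I2: "t \<le> real m - 2 * real i" if "i < I" for i
    using not_less_Least[OF that[unfolded I_def]] by simp
  have I: "i < I \<longleftrightarrow> t \<le> real m - 2 * real i" for i
  proof
    assume "t \<le> real m - 2 * real i"
    then have "real i < real I" using I1 by linarith
    then show "i < I" by simp
  qed (rule I2)
  have ID: "I \<le> D"
  proof (rule ccontr)
    assume "\<not> I \<le> D"
    then have "t \<le> real m - 2 * real D" by (intro I2) simp
    then have "2 * D \<le> m" using t by linarith
    then show False using D[of D] by simp
  qed
  have T: "T = sum q {..<I}"
    unfolding T_def sumq[OF finite_lessThan, symmetric]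
  proof (intro arg_cong[where f=prob] Collect_cong conj_cong refl iffI)
    fix \<omega> assume "\<omega> \<in> space M" "t \<le> 2 * peak \<omega> - S m \<omega>"
    then show "\<exists>i\<in>{..<I}. 2 * peak \<omega> - S m \<omega> = real m - 2 * real i"
      using pitman_support[of \<omega>] I by (metis lessThan_iff)
  next
    fix \<omega> assume "\<exists>i\<in>{..<I}. 2 * peak \<omega> - S m \<omega> = real m - 2 * real i"
    then obtain i where "i < I" "2 * peak \<omega> - S m \<omega> = real m - 2 * real i" by blast
    then show "t \<le> 2 * peak \<omega> - S m \<omega>" using I2 by presburger
  qed
  have "prob {\<omega> \<in> space M. \<exists>i\<in>{..<D}. 2 * peak \<omega> - S m \<omega> = real m - 2 * real i} = prob (space M)"
    using pitman_support D by (intro arg_cong[where f=prob]) blast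
  then have total: "sum q {..<D} = 1" using sumq[of "{..<D}"] by (simp add: prob_space)
  have "sum q {..<I} + sum q {I..<D} = sum q {..<D}"
    using sum.atLeastLessThan_concat[of 0 I D q] ID by (simp only: lessThan_atLeast0 le0)
  then have compl: "1 - T = sum q {I..<D}" using total T by linarith
  have q: "q i \<le> g (Suc i) - g i" if "i < D" for i
    unfolding q_def g_def using that D by (intro prob_pitman_le) auto
  have le1: "T \<le> g I - g 0"
  proof -
    have "T \<le> (\<Sum>i<I. g (Suc i) - g i)" unfolding T using ID by (intro sum_mono q) auto
    then show ?thesis by (simp add: sum_lessThan_telescope)
  qed
  have le2: "1 - T \<le> g D - g I"
  proof -
    have "1 - T \<le> (\<Sum>i=I..<D. g (Suc i) - g i)" unfolding compl by (intro sum_mono q) auto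
    then show ?thesis using ID by (simp add: sum_Suc_diff')
  qed
  \<comment> \<open>The argument at \<open>D\<close> is 1 or 2, depending on the parity of
    \<open>m\<close>.\<close>
  have gD: "g D \<le> majorant 0"
    unfolding g_def by (rule majorant_antimono) (auto simp: D_def)
  show ?thesis
  proof (cases "I = 0")
    case False
    \<comment> \<open>The witness is 1 plus the smallest value in the tail,
      \<open>m - 2 * (I - 1)\<close>; that value is less than one lattice step above
      \<open>t\<close>.\<close>
    have "t \<le> real m - 2 * real (I - 1)" using False by (intro I2) auto
    then have "t + 1 \<le> real m + 3 - 2 * real I" using False by (simp add: of_nat_diff)
    moreover have "real m + 3 - 2 * real I \<le> t + 3" using I1 by simp
    moreover have "0 \<le> g 0" unfolding g_def by (intro majorant_nonneg) auto
    ultimately show ?thesis using le1 le2 gD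
      by (intro exI[of _ "real m + 3 - 2 * real I"]) (auto simp: g_def)
  next
    case True
    \<comment> \<open>No value reaches \<open>t\<close>. Then \<open>m < t\<close>, so
      \<open>t + 3\<close> lies beyond the top argument \<open>m + 3\<close> and replacing
      \<open>g I\<close> by \<open>majorant (t + 3)\<close> subtracts less.\<close>
    then have "T = 0" using T by simp
    moreover have "majorant (t + 3) \<le> g I"
      unfolding g_def using I1 True by (intro majorant_antimono) auto
    moreover have "0 \<le> majorant (t + 3)" using t by (intro majorant_nonneg) auto
    ultimately show ?thesis using le2 gD by (intro exI[of _ "t + 3"]) auto
  qed
qed

text \<open>The factors of \<open>pi\<close> cancel. What precedes the tail tends to 1, so the
  majorant has almost the correct total mass.\<close>

lemma env_bessel_int:
  "env * bessel_int (real m + 2) z =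
    (real m + 2) / real (Suc m) * sqrt ((real m + 2) / real (Suc m)) * exp (1 / (2 * (real m
      + 2))) * bessel_tail (z / sqrt (real m + 2))"
proof -
  have "sqrt (2 / (pi * real (Suc m))) * (sqrt (real m + 2) * sqrt (pi / 2))
    = sqrt ((2 / (pi * real (Suc m))) * ((real m + 2) * (pi / 2)))"
    by (simp only: real_sqrt_mult)
  also have "(2 / (pi * real (Suc m))) * ((real m + 2) * (pi / 2)) = (real m + 2) / real (Suc m)"
    by (simp add: divide_simps) (simp add: algebra_simps)
  finally have "sqrt ((real m + 2) / real (Suc m))
    = sqrt (2 / (pi * real (Suc m))) * (sqrt (real m + 2) * sqrt (pi / 2))" ..
  then show ?thesis unfolding env_def bessel_int_def by (simp del: of_nat_Suc)
qed

text \<open>Error budget, in units of \<open>1 / sqrt m\<close>: 9 for variation, 1 for the excess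
  mass, 3 for rounding to the lattice, 1 for the variance \<open>m + 2\<close>. The bound on
  \<open>m\<close> absorbs the terms of second order.\<close>

lemma pitman_close:
  assumes m: "576 \<le> m" and y: "0 < y"
  shows "\<bar>prob {\<omega> \<in> space M. y * sqrt (real m) \<le> 2 * peak \<omega> - S m \<omega>} - bessel_tail y\<bar>
    \<le> 14 / sqrt (real m)"
proof -
  define T where "T = prob {\<omega> \<in> space M. y * sqrt (real m) \<le> 2 * peak \<omega> - S m \<omega>}"
  define v where "v = real m + 2"
  define u where "u = 1 / real (Suc m)"
  define s where "s = sqrt (real m)"
  define E where "E z = bessel_tail (z / sqrt v)" for z
  \<comment> \<open>The total mass of the integral part of the majorant.\<close>
  define \<kappa> where "\<kappa> = v / real (Suc m) * sqrt (v / real (Suc m)) * exp (1 / (2 * v))"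
  have s: "24 \<le> s" unfolding s_def using m by (intro real_le_rsqrt) simp
  have s2: "s * s = real m" unfolding s_def by simp
  have u: "0 < u" "u \<le> 1 / 576" "u \<le> 1 / (24 * s)"
  proof -
    have "24 * s \<le> real (Suc m)" using s s2 mult_right_mono[of 24 s s] by simp
    then show "u \<le> 1 / (24 * s)" unfolding u_def using s by (intro divide_left_mono) auto
  qed (use m in \<open>auto simp: u_def field_simps\<close>)
  have vL: "v / real (Suc m) = 1 + u" unfolding v_def u_def by (simp add: field_simps)
  have ex: "exp (1 / (2 * v)) \<le> 1 + u"
  proof -
    have "exp (1 / (2 * v)) \<le> 1 + 2 * (1 / (2 * v))"
      using exp_bound_lemma[of "1 / (2 * v)"] by (simp add: v_def)
    moreover have "2 * (1 / (2 * v)) = 1 / v" by simp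
    moreover have "1 / v \<le> u" unfolding u_def v_def by (intro divide_left_mono) auto
    ultimately show ?thesis by linarith
  qed
  have u2: "u * u \<le> u / 576" using u mult_left_mono[of u "1 / 576" u] by simp
  \<comment> \<open>Each of the three factors is at most \<open>1 + u\<close>, and \<open>u\<close>
    is small.\<close>
  have k: "\<kappa> \<le> 1 + 4 * u"
  proof -
    have "sqrt (1 + u) \<le> 1 + u" using u by (intro real_le_lsqrt) (auto simp: power2_eq_square
      algebra_simps)
    then have "(1 + u) * sqrt (1 + u) * exp (1 / (2 * v)) \<le> (1 + u) * (1 + u) * (1 + u)"
      using u ex by (intro mult_mono) auto
    also have "\<dots> = 1 + 3 * u + 3 * (u * u) + u * (u * u)" by (simp add: algebra_simps)
    also have "\<dots> \<le> 1 + 4 * u"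
    proof -
      have "u * (u * u) \<le> 1 * (u * u)" using u by (intro mult_right_mono) auto
      then show ?thesis using u u2 by linarith
    qed
    finally show ?thesis unfolding \<kappa>_def vL .
  qed
  have k0: "0 \<le> \<kappa>" unfolding \<kappa>_def v_def by simp
  \<comment> \<open>The variation term is at most \<open>env * (8 * v)\<close>, and
    \<open>env * v\<close> is at most \<open>9 / 8\<close> times \<open>1 / s\<close>.\<close>
  have R: "env * (8 * v) \<le> 9 / s"
  proof -
    have "sqrt (2 / (pi * real (Suc m))) \<le> 1 / s"
    proof -
      have "2 * real m \<le> pi * real (Suc m)" using pi_gt3 by (intro mult_mono) auto
      then have "2 / (pi * real (Suc m)) \<le> 1 / real m" using m by (simp add: field_simps)
      then have "sqrt (2 / (pi * real (Suc m))) \<le> sqrt (1 / real m)" by (rule real_sqrt_le_mono)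
      then show ?thesis by (simp add: s_def real_sqrt_divide)
    qed
    then have "sqrt (2 / (pi * real (Suc m))) * exp (1 / (2 * v)) * (v / real (Suc m))
      \<le> 1 / s * (1 + u) * (1 + u)"
      unfolding vL using ex u s by (intro mult_mono) auto
    then have "env * v \<le> 1 / s * (1 + u) * (1 + u)" unfolding env_def v_def by simp
    also have "\<dots> \<le> 1 / s * (9 / 8)"
    proof -
      have "(1 + u) * (1 + u) = 1 + 2 * u + u * u" by (simp add: algebra_simps)
      then have "(1 + u) * (1 + u) \<le> 9 / 8" using u u2 by linarith
      then have "1 / s * ((1 + u) * (1 + u)) \<le> 1 / s * (9 / 8)" using s
        by (intro mult_left_mono) auto
      then show ?thesis by (simp only: mult.assoc)
    qed
    finally show ?thesis by simp
  qed
  have maj: "\<kappa> * E z \<le> majorant z" "majorant z \<le> \<kappa> * E z + 9 / s" if z: "0 \<le> z" for z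
  proof -
    have eq: "majorant z = \<kappa> * E z + env * (2 * bessel_var v z)"
      unfolding majorant_def \<kappa>_def E_def v_def using env_bessel_int[of z]
        by (simp add: distrib_left)
    have v0: "0 < v" by (simp add: v_def)
    have "0 \<le> env * (2 * bessel_var v z)" using bessel_var_nonneg[OF v0, of z] env_nonneg by simp
    moreover have "env * (2 * bessel_var v z) \<le> env * (8 * v)"
      using bessel_var_le[OF v0 z] env_nonneg by (intro mult_left_mono) auto
    ultimately show "\<kappa> * E z \<le> majorant z" "majorant z \<le> \<kappa> * E z + 9 / s" using eq R by linarith+
  qed
  obtain j where j: "y * s + 1 \<le> j" "j \<le> y * s + 3" "T \<le> majorant j" "1 - T
    \<le> majorant 0 - majorant j"
  proof -
    have "0 < y * s" using y s by simp
    from pitman_sandwich[OF this] show ?thesis using that unfolding T_def s_def by blast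
  qed
  have j0: "0 \<le> j" using j(1) y s by (smt (verit) mult_nonneg_nonneg)
  have E01: "0 \<le> E j" "E j \<le> 1"
    using bessel_tail_nonneg[of "j / sqrt v"] bessel_tail_antimono[of 0 "j / sqrt v"] j0
    by (auto simp: E_def bessel_tail_0 v_def)
  have E0: "E 0 = 1" by (simp add: E_def bessel_tail_0)
  have su: "4 * u \<le> 1 / s" using u(3) s by (simp add: field_simps)
  have up: "T - E j \<le> 10 / s"
  proof -
    have "\<kappa> * E j \<le> (1 + 4 * u) * E j" using k E01 by (intro mult_right_mono)
    also have "\<dots> = E j + 4 * u * E j" by (simp add: algebra_simps)
    also have "4 * u * E j \<le> 4 * u * 1" using u E01 by (intro mult_left_mono) auto
    finally show ?thesis using j(3) maj(2)[OF j0] su by simp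
  qed
  \<comment> \<open>Passing to the complement leaves \<open>\<kappa> * (1 - E j)\<close>, so the
    excess mass is again charged only once.\<close>
  have low: "E j - T \<le> 10 / s"
  proof -
    have "1 - T \<le> \<kappa> * E 0 + 9 / s - \<kappa> * E j" using j(4) maj(1)[OF j0] maj(2)[OF order_refl]
      by linarith
    also have "\<dots> = \<kappa> * (1 - E j) + 9 / s" by (simp add: E0 algebra_simps)
    also have "\<kappa> * (1 - E j) \<le> (1 + 4 * u) * (1 - E j)" using k E01 by (intro mult_right_mono) auto
    also have "\<dots> = 1 - E j + 4 * u * (1 - E j)" by (simp add: algebra_simps)
    also have "4 * u * (1 - E j) \<le> 4 * u * 1" using u E01 by (intro mult_left_mono) auto
    finally show ?thesis using su by simp
  qed
  have sv: "s \<le> sqrt v" "0 < s" "0 < sqrt v" unfolding s_def v_def using m by auto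
  have shift: "\<bar>E j - E (y * s)\<bar> \<le> 3 / s"
  proof -
    have "\<bar>E j - E (y * s)\<bar> \<le> \<bar>j / sqrt v - y * s / sqrt v\<bar>" unfolding E_def
      by (rule bessel_tail_lipschitz)
    also have "\<dots> = (j - y * s) / sqrt v" using j sv by (simp flip: diff_divide_distrib)
    also have "\<dots> \<le> 3 / s" using j sv by (intro frac_le) auto
    finally show ?thesis .
  qed
  \<comment> \<open>Moves from standard deviation \<open>sqrt (m + 2)\<close> to
    \<open>sqrt m\<close>; the logarithmic estimate keeps the cost uniform in
    \<open>y\<close>.\<close>
  have scale: "\<bar>E (y * s) - bessel_tail y\<bar> \<le> 1 / s"
  proof -
    have pos: "0 < y * s / sqrt v" "y * s / sqrt v \<le> y"
      using y sv by (auto simp: pos_divide_le_eq intro: mult_left_mono divide_pos_pos)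
    have "bessel_tail (y * s / sqrt v) - bessel_tail y \<le> 2 * (ln y - ln (y * s / sqrt v))"
      by (rule bessel_tail_scale[OF pos])
    also have "ln y - ln (y * s / sqrt v) = ln (sqrt v) - ln s"
      using y sv by (simp add: ln_mult_pos ln_divide_pos)
    also have "2 * (ln (sqrt v) - ln s) = ln (v / real m)"
      using m unfolding s_def v_def by (simp add: ln_sqrt ln_divide_pos)
    also have "v / real m = 1 + 2 / real m" using m by (simp add: v_def field_simps)
    also have "ln (1 + 2 / real m) \<le> 2 / real m" by (rule ln_add_one_self_le_self) simp
    also have "\<dots> \<le> 1 / s" unfolding s2[symmetric] using s by (simp add: field_simps)
    finally have "E (y * s) - bessel_tail y \<le> 1 / s" unfolding E_def .
    moreover have "bessel_tail y \<le> E (y * s)" unfolding E_def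
      by (rule bessel_tail_antimono) (rule pos)
    ultimately show ?thesis by simp
  qed
  have "10 / s + 3 / s + 1 / s = 14 / s" by (simp flip: add_divide_distrib)
  then have "\<bar>T - bessel_tail y\<bar> \<le> 14 / s" using up low shift scale by linarith
  then show ?thesis unfolding T_def s_def .
qed

end

section \<open>Brownian motion\<close>

text \<open>Uniform continuity gives both facts: small increments limit the overshoot of the grid
  walk, and the grid maximum nearly reaches the supremum.\<close>

lemma grid_approx:
  fixes f :: "real \<Rightarrow> real"
  assumes f: "continuous_on {0..1} f" and \<delta>: "0 < \<delta>"
  shows "\<forall>\<^sub>F m in sequentially. (\<forall>k<m. f (real (Suc k) / real m) - f (real k / real m) \<le> \<delta>) \<and>
    (SUP t\<in>{0..1}. f t) \<le> Max ((\<lambda>k. f (real k / real m)) ` {..m}) + \<delta>"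
proof -
  have "uniformly_continuous_on {0..1} f" using f by (intro compact_uniformly_continuous) auto
  then obtain d where d: "0 < d" "\<And>s t. s \<in> {0..1} \<Longrightarrow> t \<in> {0..1} \<Longrightarrow> dist t s < d \<Longrightarrow> dist (f t) (f s)
    < \<delta>"
    using \<delta> unfolding uniformly_continuous_on_def by metis
  obtain m0 :: nat where m0: "1 / d < real m0" using reals_Archimedean2 by blast
  show ?thesis
  proof (rule eventually_sequentiallyI[of "max 1 m0"])
    fix m assume "max 1 m0 \<le> m"
    then have m: "1 \<le> m" "1 / d < real m" using m0 by auto
    then have md: "1 / real m < d" using d(1) by (simp add: field_simps)
    have 1: "f (real (Suc k) / real m) - f (real k / real m) \<le> \<delta>" if "k < m" for k
    proof -
      have "real (Suc k) / real m - real k / real m = 1 / real m" by (simp add: add_divide_distrib)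
      then have "dist (f (real (Suc k) / real m)) (f (real k / real m)) < \<delta>"
        using md m that by (intro d(2)) (auto simp: dist_real_def)
      then show ?thesis by (simp add: dist_real_def)
    qed
    have 2: "f t \<le> Max ((\<lambda>k. f (real k / real m)) ` {..m}) + \<delta>" if t: "t \<in> {0..1}" for t
    proof -
      \<comment> \<open>The left neighbour of \<open>t\<close> on the grid.\<close>
      define k where "k = nat \<lfloor>t * real m\<rfloor>"
      have "t * real m \<le> 1 * real m" using t by (intro mult_right_mono) auto
      then have km: "k \<le> m" unfolding k_def using t by linarith
      have k: "real k \<le> t * real m" "t * real m < real k + 1"
        unfolding k_def using t by (auto simp: of_nat_nat)
      then have "\<bar>t - real k / real m\<bar> < d" using m md by (simp add: field_simps abs_if)
      then have "dist (f t) (f (real k / real m)) < \<delta>"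
        using t km m by (intro d(2)) (auto simp: dist_real_def)
      moreover have "f (real k / real m) \<le> Max ((\<lambda>k. f (real k / real m)) ` {..m})"
        using km by (intro Max_ge) auto
      ultimately show ?thesis by (simp add: dist_real_def)
    qed
    show "(\<forall>k<m. f (real (Suc k) / real m) - f (real k / real m) \<le> \<delta>) \<and>
      (SUP t\<in>{0..1}. f t) \<le> Max ((\<lambda>k. f (real k / real m)) ` {..m}) + \<delta>"
      using 1 2 by (auto intro!: cSUP_least)
  qed
qed

lemma le_SUP_Icc:
  fixes f :: "real \<Rightarrow> real"
  assumes "continuous_on {0..1} f" "t \<in> {0..1}"
  shows "f t \<le> (SUP t\<in>{0..1}. f t)"
proof (rule cSUP_upper[OF assms(2)])
  have "compact (f ` {0..1})" using assms by (intro compact_continuous_image) auto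
  then show "bdd_above (f ` {0..1})" by (intro bounded_imp_bdd_above compact_imp_bounded)
qed

context standard_brownian_motion
begin

section \<open>Path maximum and grid maxima\<close>

definition path_max :: "'b \<Rightarrow> real" where
  "path_max \<omega> = (SUP t\<in>{0..1}. B t \<omega>)"

definition grid_max :: "nat \<Rightarrow> 'b \<Rightarrow> real" where
  "grid_max m \<omega> = Max ((\<lambda>k. B (real k / real m) \<omega>) ` {..m})"

lemma path_max_ge: "\<omega> \<in> space N \<Longrightarrow> t \<in> {0..1} \<Longrightarrow> B t \<omega> \<le> path_max \<omega>"
  unfolding path_max_def by (rule le_SUP_Icc[OF continuous_paths])

lemma path_max_nonneg: "\<omega> \<in> space N \<Longrightarrow> 0 \<le> path_max \<omega>"
  using path_max_ge[of \<omega> 0] start_0[of \<omega>] by simp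

lemma grid_max_ge_iff: "a \<le> grid_max m \<omega> \<longleftrightarrow> (\<exists>k\<le>m. a \<le> B (real k / real m) \<omega>)"
  unfolding grid_max_def by (subst Max_ge_iff) auto

lemma grid_max_le: "\<omega> \<in> space N \<Longrightarrow> grid_max m \<omega> \<le> path_max \<omega>"
  unfolding grid_max_def by (subst Max_le_iff) (auto intro!: path_max_ge simp: divide_le_eq_1)

lemma measurable_B [measurable]: "t \<in> {0..1} \<Longrightarrow> B t \<in> borel_measurable N"
  by (rule random_variable_B)

lemma measurable_grid_max [measurable]: "grid_max m \<in> borel_measurable N"
  unfolding grid_max_def[abs_def] by (intro borel_measurable_Max measurable_B) (auto simp:
    divide_le_eq_1)

text \<open>The supremum ranges over uncountably many times, but on every path it is the limit of
  the grid maxima.\<close>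

lemma measurable_path_max [measurable]: "path_max \<in> borel_measurable N"
proof (rule borel_measurable_LIMSEQ_real)
  fix \<omega> assume \<omega>: "\<omega> \<in> space N"
  show "(\<lambda>m. grid_max m \<omega>) \<longlonglongrightarrow> path_max \<omega>"
  proof (rule tendstoI)
    fix e :: real assume "0 < e"
    then have "\<forall>\<^sub>F m in sequentially. path_max \<omega> \<le> grid_max m \<omega> + e / 2"
      using grid_approx[OF continuous_paths[OF \<omega>], of "e / 2"]
      unfolding path_max_def grid_max_def by (auto elim: eventually_mono)
    then show "\<forall>\<^sub>F m in sequentially. dist (grid_max m \<omega>) (path_max \<omega>) < e"
    proof (rule eventually_mono)
      fix m assume "path_max \<omega> \<le> grid_max m \<omega> + e / 2"
      then show "dist (grid_max m \<omega>) (path_max \<omega>) < e"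
        using grid_max_le[OF \<omega>, of m] \<open>0 < e\<close> by (simp add: dist_real_def)
    qed
  qed
qed simp

definition incr :: "nat \<Rightarrow> nat \<Rightarrow> 'b \<Rightarrow> real" where
  "incr m k \<omega> = B (real (Suc k) / real m) \<omega> - B (real k / real m) \<omega>"

lemma symmetric_walk_incr:
  assumes "1 \<le> m"
  shows "symmetric_walk N (incr m) m"
proof
  have "mono_on {0..m} (\<lambda>i. real i / real m)" by (intro mono_onI divide_right_mono) auto
  moreover have "(\<lambda>i. real i / real m) ` {0..m} \<subseteq> {0..1}" using assms by auto
  ultimately show "indep_vars (\<lambda>_. borel) (incr m) {..<m}"
    using independent_increments[of m "\<lambda>i. real i / real m"] unfolding incr_def[abs_def] by simp
next
  fix i assume i: "i < m"
  define s where "s = sqrt (real (Suc i) / real m - real i / real m)"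
  have s: "0 < s" unfolding s_def using i by (simp add: divide_strict_right_mono)
  have 1: "distributed N lborel (incr m i) (normal_density 0 s)"
    unfolding incr_def[abs_def] s_def using i
    by (intro normal_increments) (auto simp: divide_strict_right_mono)
  from normal_density_affine[OF 1 s, of "-1" 0]
  have 2: "distributed N lborel (\<lambda>\<omega>. - incr m i \<omega>) (normal_density 0 s)" by simp
  have "distr N lborel (\<lambda>\<omega>. - incr m i \<omega>) = distr N lborel (incr m i)"
    using 1 2 by (simp add: distributed_def)
  then show "distr N borel (\<lambda>\<omega>. - incr m i \<omega>) = distr N borel (incr m i)"
    by (metis distr_cong sets_lborel)
qed

lemma prob_B1: "A \<in> sets borel \<Longrightarrow> prob {\<omega> \<in> space N. B 1 \<omega> \<in> A}
  = measure (density lborel std_normal_density) A"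
proof -
  assume A: "A \<in> sets borel"
  have "distributed N lborel (\<lambda>\<omega>. B 1 \<omega> - B 0 \<omega>) std_normal_density"
    using normal_increments[of 0 1] by simp
  from std_normal_distr[OF prob_space_axioms this A] show ?thesis
    by (metis (mono_tags, lifting) Collect_cong diff_zero start_0)
qed

lemma prob_B1_ge: "prob {\<omega> \<in> space N. y \<le> B 1 \<omega>} = gauss_tail y"
  using prob_B1[of "{y..}"] by (simp add: gauss_tail_def)

lemma prob_B1_gt: "prob {\<omega> \<in> space N. y < B 1 \<omega>} = gauss_tail y"
proof -
  have "{y..} = {y<..} \<union> {y}" by auto
  then have "gauss_tail y = measure (density lborel std_normal_density) ({y<..} \<union> {y})"
    by (simp add: gauss_tail_def)
  also have "\<dots> = measure (density lborel std_normal_density) {y<..}"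
    by (subst std_normal.finite_measure_Union) (auto simp: std_normal_singleton)
  finally show ?thesis using prob_B1[of "{y<..}"] by simp
qed

text \<open>The paths for which the grid of mesh \<open>1 / m\<close> fails at tolerance
  \<open>\<delta>\<close>: an upward step large enough to overshoot a level, or a maximum missed by
  more than \<open>\<delta>\<close>.\<close>

definition bad :: "real \<Rightarrow> nat \<Rightarrow> 'b set" where
  "bad \<delta> m = {\<omega> \<in> space N. (\<exists>k<m. \<delta> < incr m k \<omega>) \<or> grid_max m \<omega> + \<delta> < path_max \<omega>}"

lemma measurable_incr [measurable]: "k < m \<Longrightarrow> incr m k \<in> borel_measurable N"
  unfolding incr_def[abs_def] by (intro borel_measurable_diff measurable_B) (auto simp:
    divide_le_eq_1)

lemma sets_bad_incr [measurable]: "{\<omega> \<in> space N. \<exists>k<m. \<delta> < incr m k \<omega>} \<in> sets N"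
proof -
  have "{\<omega> \<in> space N. \<exists>k<m. \<delta> < incr m k \<omega>} = (\<Union>k\<in>{..<m}. {\<omega> \<in> space N. \<delta> < incr m k \<omega>})" by auto
  also have "\<dots> \<in> sets N" by (intro sets.finite_UN) auto
  finally show ?thesis .
qed

lemma sets_bad [measurable]: "bad \<delta> m \<in> sets N"
proof -
  have "bad \<delta> m = {\<omega> \<in> space N. \<exists>k<m. \<delta> < incr m k \<omega>} \<union> {\<omega> \<in> space N. grid_max m \<omega> + \<delta>
    < path_max \<omega>}"
    unfolding bad_def by auto
  also have "\<dots> \<in> sets N" by (intro sets.Un sets_bad_incr) measurable
  finally show ?thesis .
qed

text \<open>Every path eventually leaves the bad sets, so dominated convergence applies. A limit
  without rate suffices, as \<open>\<delta>\<close> stays fixed while the grid is refined.\<close>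

lemma prob_bad_tendsto_0:
  assumes "0 < \<delta>"
  shows "(\<lambda>m. prob (bad \<delta> m)) \<longlonglongrightarrow> 0"
proof -
  have "(\<lambda>m. \<integral>\<omega>. indicator (bad \<delta> m) \<omega> \<partial>N) \<longlonglongrightarrow> (\<integral>\<omega>. (0::real) \<partial>N)"
  proof (rule integral_dominated_convergence[where w = "\<lambda>_. 1"])
    show "AE \<omega> in N. (\<lambda>m. indicator (bad \<delta> m) \<omega> :: real) \<longlonglongrightarrow> 0"
    proof (rule AE_I2)
      fix \<omega> assume "\<omega> \<in> space N"
      from grid_approx[OF continuous_paths[OF this] assms]
      have "\<forall>\<^sub>F m in sequentially. \<omega> \<notin> bad \<delta> m"
        by (rule eventually_mono) (force simp: bad_def incr_def path_max_def grid_max_def)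
      then have "\<forall>\<^sub>F m in sequentially. indicator (bad \<delta> m) \<omega> = (0 :: real)"
        by (rule eventually_mono) simp
      then show "(\<lambda>m. indicator (bad \<delta> m) \<omega> :: real) \<longlonglongrightarrow> 0" by (rule tendsto_eventually)
    qed
  qed (auto split: split_indicator)
  then show ?thesis by simp
qed

text \<open>The Brownian reflection principle. Up to the bad set, grid walks bracket the probability
  between Gaussian tails shifted by \<open>2 * \<delta>\<close>; the mesh tends to zero first, then
  \<open>\<delta>\<close>, by continuity of \<open>gauss_tail\<close>.\<close>

lemma prob_max_end:
  assumes "0 \<le> a" "c \<le> a"
  shows "prob {\<omega> \<in> space N. a \<le> path_max \<omega> \<and> B 1 \<omega> \<le> c} = gauss_tail (2 * a - c)"
proof -
  let ?p = "prob {\<omega> \<in> space N. a \<le> path_max \<omega> \<and> B 1 \<omega> \<le> c}"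
  have [measurable]: "B 1 \<in> borel_measurable N" by simp
  have grid: "prob {\<omega> \<in> space N. x \<le> grid_max m \<omega> \<and> B 1 \<omega> \<le> c} \<le> gauss_tail (2 * x - c)"
      "0 \<le> x \<Longrightarrow> c \<le> x \<Longrightarrow> 0 \<le> \<delta> \<Longrightarrow> gauss_tail (2 * x + 2 * \<delta> - c) \<le>
        prob {\<omega> \<in> space N. x \<le> grid_max m \<omega> \<and> B 1 \<omega> \<le> c} + prob {\<omega> \<in> space N. \<exists>k<m. \<delta> < incr m k \<omega>}"
    if m: "1 \<le> m" for m x \<delta>
  proof -
    interpret W: symmetric_walk N "incr m" m by (rule symmetric_walk_incr[OF m])
    have S: "W.S k \<omega> = B (real k / real m) \<omega>" if "\<omega> \<in> space N" for k \<omega>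
      unfolding W.S_def incr_def
      using sum_lessThan_telescope[of "\<lambda>k. B (real k / real m) \<omega>" k] start_0[OF that] by simp
    have 1: "{\<omega> \<in> space N. (\<exists>k\<le>m. x \<le> W.S k \<omega>) \<and> W.S m \<omega> \<le> c} = {\<omega> \<in> space N. x
      \<le> grid_max m \<omega> \<and> B 1 \<omega> \<le> c}"
      using m by (auto simp: S grid_max_ge_iff)
    have 2: "prob {\<omega> \<in> space N. y \<le> W.S m \<omega>} = gauss_tail y" for y
      unfolding prob_B1_ge[symmetric] by (intro arg_cong[where f=prob]) (use m in \<open>auto simp: S\<close>)
    show "prob {\<omega> \<in> space N. x \<le> grid_max m \<omega> \<and> B 1 \<omega> \<le> c} \<le> gauss_tail (2 * x - c)"
      using W.hitting_upper[of x c] unfolding 1 2 .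
    show "gauss_tail (2 * x + 2 * \<delta> - c) \<le>
        prob {\<omega> \<in> space N. x \<le> grid_max m \<omega> \<and> B 1 \<omega> \<le> c} + prob {\<omega> \<in> space N. \<exists>k<m. \<delta> < incr m k \<omega>}"
      if "0 \<le> x" "c \<le> x" "0 \<le> \<delta>"
      using W.hitting_lower[OF that] unfolding 1 2 .
  qed
  \<comment> \<open>The grid may miss the maximum by \<open>\<delta>\<close>, so the level is
    lowered to \<open>a - \<delta>\<close>.\<close>
  have upper: "?p \<le> gauss_tail (2 * a - 2 * \<delta> - c)" if \<delta>: "0 < \<delta>" for \<delta>
  proof -
    have "?p \<le> gauss_tail (2 * a - 2 * \<delta> - c) + prob (bad \<delta> m)" if m: "1 \<le> m" for m
    proof -
      have "?p \<le> prob ({\<omega> \<in> space N. a - \<delta> \<le> grid_max m \<omega> \<and> B 1 \<omega> \<le> c} \<union> bad \<delta> m)"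
        by (intro finite_measure_mono) (auto simp: bad_def)
      also have "\<dots> \<le> prob {\<omega> \<in> space N. a - \<delta> \<le> grid_max m \<omega> \<and> B 1 \<omega> \<le> c} + prob (bad \<delta> m)"
        by (rule measure_Un_le) auto
      also have "\<dots> \<le> gauss_tail (2 * (a - \<delta>) - c) + prob (bad \<delta> m)"
        using grid(1)[OF m] by (intro add_right_mono)
      finally show ?thesis by (simp add: algebra_simps)
    qed
    then have "\<forall>\<^sub>F m in sequentially. ?p \<le> gauss_tail (2 * a - 2 * \<delta> - c) + prob (bad \<delta> m)"
      by (intro eventually_sequentiallyI)
    moreover have "(\<lambda>m. gauss_tail (2 * a - 2 * \<delta> - c) + prob (bad \<delta> m))
      \<longlonglongrightarrow> gauss_tail (2 * a - 2 * \<delta> - c) + 0"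
      by (intro tendsto_add tendsto_const prob_bad_tendsto_0 \<delta>)
    ultimately show ?thesis using tendsto_lowerbound[of _ _ sequentially ?p] by auto
  qed
  \<comment> \<open>The grid maximum lies below the path maximum, so the level stays; the loss comes
    from overshoot.\<close>
  have lower: "gauss_tail (2 * a + 2 * \<delta> - c) \<le> ?p" if \<delta>: "0 < \<delta>" for \<delta>
  proof -
    have "gauss_tail (2 * a + 2 * \<delta> - c) \<le> ?p + prob (bad \<delta> m)" if m: "1 \<le> m" for m
    proof -
      have "gauss_tail (2 * a + 2 * \<delta> - c) \<le>
        prob {\<omega> \<in> space N. a \<le> grid_max m \<omega> \<and> B 1 \<omega> \<le> c} + prob {\<omega> \<in> space N. \<exists>k<m. \<delta> < incr m k \<omega>}"
        using assms \<delta> by (intro grid(2) m) auto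
      also have "\<dots> \<le> ?p + prob (bad \<delta> m)"
      proof (rule add_mono; rule finite_measure_mono)
        show "{\<omega> \<in> space N. a \<le> grid_max m \<omega> \<and> B 1 \<omega> \<le> c} \<subseteq> {\<omega> \<in> space N. a \<le> path_max \<omega> \<and> B 1 \<omega>
          \<le> c}"
          using grid_max_le[of _ m] by fastforce
        show "{\<omega> \<in> space N. \<exists>k<m. \<delta> < incr m k \<omega>} \<subseteq> bad \<delta> m" unfolding bad_def by auto
        show "{\<omega> \<in> space N. a \<le> path_max \<omega> \<and> B 1 \<omega> \<le> c} \<in> sets N" by measurable
      qed (rule sets_bad)
      finally show ?thesis .
    qed
    then have "\<forall>\<^sub>F m in sequentially. gauss_tail (2 * a + 2 * \<delta> - c) \<le> ?p + prob (bad \<delta> m)"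
      by (intro eventually_sequentiallyI)
    moreover have "(\<lambda>m. ?p + prob (bad \<delta> m)) \<longlonglongrightarrow> ?p + 0"
      by (intro tendsto_add tendsto_const prob_bad_tendsto_0 \<delta>)
    ultimately show ?thesis using tendsto_lowerbound[of _ _ sequentially "gauss_tail (2 * a + 2
      * \<delta> - c)"] by auto
  qed
  have cont: "isCont gauss_tail y" for y by (rule DERIV_isCont[OF DERIV_gauss_tail])
  have "((\<lambda>\<delta>. gauss_tail (2 * a - 2 * \<delta> - c)) \<longlongrightarrow> gauss_tail (2 * a - 2 * 0 - c)) (at_right 0)"
    by (rule isCont_tendsto_compose[OF cont]) (intro tendsto_intros)
  then have "?p \<le> gauss_tail (2 * a - 2 * 0 - c)"
    by (rule tendsto_lowerbound) (auto simp: eventually_at_right_less intro!: eventually_mono[OF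
      eventually_at_right_less] upper)
  moreover have "((\<lambda>\<delta>. gauss_tail (2 * a + 2 * \<delta> - c)) \<longlongrightarrow> gauss_tail (2 * a + 2 * 0
    - c)) (at_right 0)"
    by (rule isCont_tendsto_compose[OF cont]) (intro tendsto_intros)
  then have "gauss_tail (2 * a + 2 * 0 - c) \<le> ?p"
    by (rule tendsto_upperbound) (auto intro!: eventually_mono[OF eventually_at_right_less] lower)
  ultimately show ?thesis by simp
qed

text \<open>An end point above \<open>a\<close> forces the maximum above \<open>a\<close>; splitting
  there gives \<open>2 * gauss_tail a\<close> for the maximum alone, and the rest is
  complementation.\<close>

lemma prob_max_end_gt:
  assumes "0 \<le> a" "c \<le> a"
  shows "prob {\<omega> \<in> space N. a \<le> path_max \<omega> \<and> c < B 1 \<omega>} = 2 * gauss_tail a - gauss_tail (2 * a - c)"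
proof -
  have [measurable]: "B 1 \<in> borel_measurable N" by simp
  have m: "prob {\<omega> \<in> space N. a \<le> path_max \<omega>} = 2 * gauss_tail a"
  proof -
    have eq: "{\<omega> \<in> space N. a \<le> path_max \<omega>} = {\<omega> \<in> space N. a \<le> path_max \<omega> \<and> B 1 \<omega> \<le> a}
      \<union> {\<omega> \<in> space N. a < B 1 \<omega>}"
      using path_max_ge[of _ 1] by force
    have "prob {\<omega> \<in> space N. a \<le> path_max \<omega>} = prob {\<omega> \<in> space N. a \<le> path_max \<omega> \<and> B 1 \<omega>
      \<le> a} + prob {\<omega> \<in> space N. a < B 1 \<omega>}"
      by (subst eq, rule finite_measure_Union) auto
    then show ?thesis using prob_max_end[of a a] assms by (simp add: prob_B1_gt)
  qed
  have eq: "{\<omega> \<in> space N. a \<le> path_max \<omega>} = {\<omega> \<in> space N. a \<le> path_max \<omega> \<and> B 1 \<omega> \<le> c}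
    \<union> {\<omega> \<in> space N. a \<le> path_max \<omega> \<and> c < B 1 \<omega>}"
    by auto
  have "prob {\<omega> \<in> space N. a \<le> path_max \<omega>} = prob {\<omega> \<in> space N. a \<le> path_max \<omega> \<and> B 1 \<omega>
    \<le> c} + prob {\<omega> \<in> space N. a \<le> path_max \<omega> \<and> c < B 1 \<omega>}"
    by (subst eq, rule finite_measure_Union) auto
  then show ?thesis using prob_max_end[OF assms] m by simp
qed

text \<open>Meant for \<open>c = 2 * a - r\<close> and \<open>c = 2 * b - r\<close>, where one of
  the last two arguments becomes \<open>r\<close>, the same for all slices.\<close>

lemma prob_slice:
  assumes "0 \<le> a" "c \<le> a" "a \<le> b"
  shows "prob {\<omega> \<in> space N. a \<le> path_max \<omega> \<and> path_max \<omega> < b \<and> c < B 1 \<omega>}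
    = 2 * gauss_tail a - 2 * gauss_tail b - (gauss_tail (2 * a - c) - gauss_tail (2 * b - c))"
proof -
  have [measurable]: "B 1 \<in> borel_measurable N" by simp
  have eq: "{\<omega> \<in> space N. a \<le> path_max \<omega> \<and> c < B 1 \<omega>}
    = {\<omega> \<in> space N. a \<le> path_max \<omega> \<and> path_max \<omega> < b \<and> c < B 1 \<omega>} \<union> {\<omega> \<in> space N. b
      \<le> path_max \<omega> \<and> c < B 1 \<omega>}"
    using assms by auto
  have "prob {\<omega> \<in> space N. a \<le> path_max \<omega> \<and> c < B 1 \<omega>} = prob {\<omega> \<in> space N. a
    \<le> path_max \<omega> \<and> path_max \<omega> < b \<and> c < B 1 \<omega>} + prob {\<omega> \<in> space N. b \<le> path_max \<omega> \<and> c < B 1 \<omega>}"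
    by (subst eq, rule finite_measure_Union) auto
  then show ?thesis using prob_max_end_gt[of a c] prob_max_end_gt[of b c] assms by simp
qed

text \<open>Cut the event \<open>2 * max B - B 1 < r\<close> into slices in which the maximum varies by \<open>h = r / n\<close>.
  Replacing the maximum by an end point of its slice makes every slice computable by reflection:
  the terms \<open>gauss_tail a\<close> telescope, and each slice loses \<open>gauss_tail r - gauss_tail (r + 2 * h)\<close>,
  up to sign and shift, which in total tends to \<open>2 * r\<close> times the normal density at \<open>r\<close>.\<close>
lemma prob_bessel:
  assumes r: "0 < r"
  shows "prob {\<omega> \<in> space N. r \<le> 2 * path_max \<omega> - B 1 \<omega>} = bessel_tail r"
proof -
  have [measurable]: "B 1 \<in> borel_measurable N" by simp
  define V where "V = prob {\<omega> \<in> space N. 2 * path_max \<omega> - B 1 \<omega> < r}"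
  define slice where "slice a b c = {\<omega> \<in> space N. a \<le> path_max \<omega> \<and> path_max \<omega> < b \<and> c
    < B 1 \<omega>}" for a b c
  have [measurable]: "slice a b c \<in> sets N" for a b c unfolding slice_def by measurable
  have tele: "(\<Sum>i<n. 2 * gauss_tail (f i) - 2 * gauss_tail (f (Suc i)) - d)
    = 2 * gauss_tail (f 0) - 2 * gauss_tail (f n) - real n * d"
    for f :: "nat \<Rightarrow> real" and n d
    by (induction n) (simp_all add: algebra_simps)
  \<comment> \<open>The left end of each slice replaces the maximum, which enlarges the event. The
    slices below \<open>r\<close> suffice, as \<open>B 1\<close> is at most the maximum.\<close>
  have upper: "V \<le> 2 * gauss_tail 0 - 2 * gauss_tail r - real (Suc n) * (gauss_tail r
    - gauss_tail (r + 2 * (r / real (Suc n))))" for n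
  proof -
    define h where "h = r / real (Suc n)"
    have h: "0 < h" "real (Suc n) * h = r" using r by (simp_all add: h_def)
    have "V \<le> prob (\<Union>i\<in>{..<Suc n}. slice (real i * h) (real (Suc i) * h) (2 * (real i * h) - r))"
      unfolding V_def
    proof (intro finite_measure_mono subsetI)
      fix \<omega> assume \<omega>: "\<omega> \<in> {\<omega> \<in> space N. 2 * path_max \<omega> - B 1 \<omega> < r}"
      then have M: "0 \<le> path_max \<omega>" "B 1 \<omega> \<le> path_max \<omega>" "path_max \<omega> < r"
        using path_max_nonneg[of \<omega>] path_max_ge[of \<omega> 1] by auto
      define i where "i = nat \<lfloor>path_max \<omega> / h\<rfloor>"
      have i0: "0 \<le> path_max \<omega> / h" using M h by simp
      then have "real i \<le> path_max \<omega> / h" "path_max \<omega> / h < real i + 1"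
        unfolding i_def by (auto simp: of_nat_nat)
      then have i: "real i * h \<le> path_max \<omega>" "path_max \<omega> < real (Suc i) * h"
        using h by (auto simp: field_simps)
      have "real i * h < real (Suc n) * h" using i(1) M h by linarith
      then have "i < Suc n" using h(1) by (simp add: mult_less_cancel_right_disj)
      moreover have "2 * (real i * h) - r < B 1 \<omega>" using i(1) \<omega> by auto
      ultimately show "\<omega> \<in> (\<Union>i\<in>{..<Suc n}. slice (real i * h) (real (Suc i) * h) (2 * (real i * h)
        - r))"
        using i \<omega> unfolding slice_def by blast
    qed auto
    also have "\<dots> \<le> (\<Sum>i<Suc n. prob (slice (real i * h) (real (Suc i) * h) (2 * (real i * h) - r)))"
      by (intro finite_measure_subadditive_finite) auto
    also have "\<dots> = (\<Sum>i<Suc n. 2 * gauss_tail (real i * h) - 2 * gauss_tail (real (Suc i) * h)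
        - (gauss_tail r - gauss_tail (r + 2 * h)))"
    proof (intro sum.cong refl)
      fix i assume "i \<in> {..<Suc n}"
      then have "real i * h \<le> real (Suc n) * h" using h by (intro mult_right_mono) auto
      then have le: "2 * (real i * h) - r \<le> real i * h" using h by linarith
      have a: "2 * (real i * h) - (2 * (real i * h) - r)
        = r" "2 * (real (Suc i) * h) - (2 * (real i * h) - r) = r + 2 * h"
        by (simp_all add: algebra_simps)
      have le2: "0 \<le> real i * h" "real i * h \<le> real (Suc i) * h" using h
        by (auto intro: mult_right_mono)
      show "prob (slice (real i * h) (real (Suc i) * h) (2 * (real i * h) - r))
        = 2 * gauss_tail (real i * h) - 2 * gauss_tail (real (Suc i) * h)
        - (gauss_tail r - gauss_tail (r + 2 * h))"
        using prob_slice[OF le2(1) le le2(2)] unfolding slice_def a .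
    qed
    also have "\<dots> = 2 * gauss_tail (real 0 * h) - 2 * gauss_tail (real (Suc n) * h) - real (Suc n)
      * (gauss_tail r - gauss_tail (r + 2 * h))"
      by (rule tele)
    finally show ?thesis unfolding h(2) unfolding h_def by simp
  qed
  \<comment> \<open>The right end shrinks the event. Reflection requires
    \<open>2 * (i + 1) * h - r \<le> i * h\<close>, that is \<open>i + 2 \<le> n + 1\<close>, so
    only \<open>n\<close> slices remain.\<close>
  have lower: "2 * gauss_tail 0 - 2 * gauss_tail (r - r / real (Suc n)) - real n * (gauss_tail (r
    + 2 * (- r / real (Suc n))) - gauss_tail r) \<le> V" for n
  proof -
    define h where "h = r / real (Suc n)"
    have h: "0 < h" "real (Suc n) * h = r" "real n * h = r - h" using r
      by (simp_all add: h_def field_simps)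
    have "2 * gauss_tail (real 0 * h) - 2 * gauss_tail (real n * h) - real n * (gauss_tail (r - 2
      * h) - gauss_tail r)
      = (\<Sum>i<n. 2 * gauss_tail (real i * h) - 2 * gauss_tail (real (Suc i) * h) - (gauss_tail (r
        - 2 * h) - gauss_tail r))"
      by (rule tele[symmetric])
    also have "\<dots> = (\<Sum>i<n. prob (slice (real i * h) (real (Suc i) * h) (2 * (real (Suc i) * h)
      - r)))"
    proof (intro sum.cong refl)
      fix i assume "i \<in> {..<n}"
      then have "real (i + 2) * h \<le> real (Suc n) * h" using h by (intro mult_right_mono) auto
      then have le: "2 * (real (Suc i) * h) - r \<le> real i * h" using h by (simp add: algebra_simps)
      have a: "2 * (real i * h) - (2 * (real (Suc i) * h) - r)
        = r - 2 * h" "2 * (real (Suc i) * h) - (2 * (real (Suc i) * h) - r) = r"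
        by (simp_all add: algebra_simps)
      have le2: "0 \<le> real i * h" "real i * h \<le> real (Suc i) * h" using h
        by (auto intro: mult_right_mono)
      show "2 * gauss_tail (real i * h) - 2 * gauss_tail (real (Suc i) * h) - (gauss_tail (r - 2
        * h) - gauss_tail r)
        = prob (slice (real i * h) (real (Suc i) * h) (2 * (real (Suc i) * h) - r))"
        using prob_slice[OF le2(1) le le2(2)] unfolding slice_def a by (rule sym)
    qed
    also have "\<dots> = prob (\<Union>i\<in>{..<n}. slice (real i * h) (real (Suc i) * h) (2 * (real (Suc i) * h)
      - r))"
    proof (rule finite_measure_finite_Union[symmetric])
      have "i = j" if "\<omega> \<in> slice (real i * h) (real (Suc i) * h) c" "\<omega> \<in> slice (real j
        * h) (real (Suc j) * h) d" for i j \<omega> c d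
      proof -
        have "real i * h < real (Suc j) * h" "real j * h < real (Suc i) * h" using that
          by (auto simp: slice_def)
        then show ?thesis using h(1) by (simp add: mult_less_cancel_right_disj del: of_nat_Suc)
      qed
      then show "disjoint_family_on (\<lambda>i. slice (real i * h) (real (Suc i) * h) (2 * (real (Suc i)
        * h) - r)) {..<n}"
        unfolding disjoint_family_on_def by blast
    qed auto
    also have "\<dots> \<le> V" unfolding V_def
      by (intro finite_measure_mono) (auto simp: slice_def)
    finally show ?thesis unfolding h(3) unfolding h_def by simp
  qed
  let ?v = "2 * gauss_tail 0 - 2 * gauss_tail r - 2 * r * std_normal_density r"
  have "V \<le> ?v"
  proof (rule tendsto_lowerbound)
    show "(\<lambda>n. 2 * gauss_tail 0 - 2 * gauss_tail r - real (Suc n) * (gauss_tail r - gauss_tail (r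
      + 2 * (r / real (Suc n))))) \<longlonglongrightarrow> ?v"
      using r by (intro tendsto_intros gauss_tail_difference_quotient) auto
  qed (use upper in auto)
  moreover have "?v \<le> V"
  proof (rule tendsto_upperbound)
    have "isCont gauss_tail r" by (rule DERIV_isCont[OF DERIV_gauss_tail])
    moreover have "(\<lambda>n. r - r / real (Suc n)) \<longlonglongrightarrow> r - 0"
      by (intro tendsto_diff tendsto_const) (real_asymp)
    ultimately have 1: "(\<lambda>n. gauss_tail (r - r / real (Suc n))) \<longlonglongrightarrow> gauss_tail r"
      using isCont_tendsto_compose by force
    \<comment> \<open>Accounts for the missing last slice.\<close>
    have 2: "(\<lambda>n. real n / real (Suc n)) \<longlonglongrightarrow> 1" by real_asymp
    have shift: "(\<lambda>n. real (Suc n) * (gauss_tail (r + 2 * (- r / real (Suc n))) - gauss_tail r))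
      \<longlonglongrightarrow> 2 * r * std_normal_density r"
      using tendsto_minus[OF gauss_tail_difference_quotient[of "- r" r]] r
        by (simp add: algebra_simps)
    have "(\<lambda>n. 2 * gauss_tail 0 - 2 * gauss_tail (r - r / real (Suc n)) -
        (real n / real (Suc n)) * (real (Suc n) * (gauss_tail (r + 2 * (- r / real (Suc n)))
          - gauss_tail r))) \<longlonglongrightarrow>
        2 * gauss_tail 0 - 2 * gauss_tail r - 1 * (2 * r * std_normal_density r)"
      by (intro tendsto_intros 1 2 shift)
    then show "(\<lambda>n. 2 * gauss_tail 0 - 2 * gauss_tail (r - r / real (Suc n)) -
        real n * (gauss_tail (r + 2 * (- r / real (Suc n))) - gauss_tail r)) \<longlonglongrightarrow> ?v"
      by simp
  qed (use lower in auto)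
  ultimately have V: "V = ?v" by simp
  have eq: "{\<omega> \<in> space N. r \<le> 2 * path_max \<omega> - B 1 \<omega>}
    = space N - {\<omega> \<in> space N. 2 * path_max \<omega> - B 1 \<omega> < r}" by auto
  have "prob {\<omega> \<in> space N. r \<le> 2 * path_max \<omega> - B 1 \<omega>} = 1 - V"
    unfolding V_def by (subst eq, rule prob_compl) measurable
  then show ?thesis using gauss_tail_minus[of 0] unfolding V by (simp add: bessel_tail_def)
qed

lemma prob_bessel_nonpos:
  assumes "r \<le> 0"
  shows "prob {\<omega> \<in> space N. r \<le> 2 * path_max \<omega> - B 1 \<omega>} = 1"
proof -
  have "{\<omega> \<in> space N. r \<le> 2 * path_max \<omega> - B 1 \<omega>} = space N"
    using path_max_nonneg path_max_ge[of _ 1] assms by force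
  then show ?thesis by (simp add: prob_space)
qed

end

section \<open>Longest increasing subsequences over two letters\<close>

text \<open>The cut \<open>k\<close> is the position of the last \<open>\<alpha>\<close> in the
  subsequence: monotonicity forces \<open>\<alpha>\<close> before it, and only
  \<open>\<beta>\<close> can follow. Conversely, the positions counted for any cut form an
  increasing subsequence.\<close>

lemma longest_incr_subseq_ge_iff:
  fixes x :: "nat \<Rightarrow> 'l::linorder"
  assumes "\<alpha> < \<beta>" and x: "\<And>i. i \<in> {1..n} \<Longrightarrow> x i \<in> {\<alpha>, \<beta>}"
  shows "y \<le> real (longest_incr_subseq x n) \<longleftrightarrow>
    (\<exists>k\<le>n. y \<le> real (card {i \<in> {1..k}. x i = \<alpha>} + card {i \<in> {k<..n}. x i = \<beta>}))"
proof -
  define J where "J = {j. \<exists>i :: nat \<Rightarrow> nat. strict_mono_on {1..j} i \<and> i ` {1..j} \<subseteq> {1..n} \<and>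
                mono_on {1..j} (\<lambda>k. x (i k))}"
  define f where "f k = card {i \<in> {1..k}. x i = \<alpha>} + card {i \<in> {k<..n}. x i = \<beta>}" for k
  have le: "\<exists>k\<le>n. j \<le> f k" if "j \<in> J" for j
  proof -
    from that obtain i where i: "strict_mono_on {1..j} i" "i ` {1..j} \<subseteq> {1..n}"
      "mono_on {1..j} (\<lambda>k. x (i k))" unfolding J_def by auto
    \<comment> \<open>Inserting 0 provides the cut \<open>k = 0\<close> for subsequences without
      \<open>\<alpha>\<close>.\<close>
    define A where "A = insert 0 {i l | l. l \<in> {1..j} \<and> x (i l) = \<alpha>}"
    define k where "k = Max A"
    have A: "finite A" "A \<noteq> {}" unfolding A_def by auto
    have "A \<subseteq> {..n}" using i(2) unfolding A_def by (auto simp: image_subset_iff)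
    then have "k \<le> n" using Max_in[OF A] unfolding k_def by auto
    have sub: "i ` {1..j} \<subseteq> {i \<in> {1..k}. x i = \<alpha>} \<union> {i \<in> {k<..n}. x i = \<beta>}"
    proof
      fix p assume "p \<in> i ` {1..j}"
      then obtain l where l: "l \<in> {1..j}" "p = i l" by auto
      then have p: "p \<in> {1..n}" using i(2) by blast
      show "p \<in> {i \<in> {1..k}. x i = \<alpha>} \<union> {i \<in> {k<..n}. x i = \<beta>}"
      proof (cases "p \<le> k")
        case True
        then have "k \<noteq> 0" using p by auto
        then obtain l0 where l0: "l0 \<in> {1..j}" "k = i l0" "x (i l0) = \<alpha>"
          using Max_in[OF A] unfolding k_def[symmetric] unfolding A_def by auto
        have "l \<le> l0"
        proof (rule ccontr)
          assume "\<not> l \<le> l0"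
          then have "i l0 < i l" using i(1) l l0 by (auto simp: strict_mono_on_def)
          with True l l0 show False by simp
        qed
        then have "x (i l) \<le> \<alpha>" using i(3) l(1) l0 by (metis mono_onD)
        then have "x p = \<alpha>" using x[OF p] l assms(1) by auto
        then show ?thesis using True p by simp
      next
        case False
        have "x p \<noteq> \<alpha>"
        proof
          assume "x p = \<alpha>"
          then have "p \<in> A" using l unfolding A_def by auto
          then have "p \<le> k" unfolding k_def using A by simp
          with False show False ..
        qed
        then show ?thesis using x[OF p] False p by simp
      qed
    qed
    have "j = card (i ` {1..j})" using i(1) by (simp add: card_image strict_mono_on_imp_inj_on)
    also have "\<dots> \<le> card ({i \<in> {1..k}. x i = \<alpha>} \<union> {i \<in> {k<..n}. x i = \<beta>})"
      by (rule card_mono[OF _ sub]) simp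
    also have "\<dots> \<le> f k" unfolding f_def by (rule card_Un_le)
    finally show ?thesis using \<open>k \<le> n\<close> by auto
  qed
  have ge: "f k \<in> J" if "k \<le> n" for k
  proof -
    define I where "I = {i \<in> {1..k}. x i = \<alpha>} \<union> {i \<in> {k<..n}. x i = \<beta>}"
    have card: "card I = f k" unfolding I_def f_def by (rule card_Un_disjoint) auto
    obtain h where h: "bij_betw h {..<card I} I" "strict_mono_on {..<card I} h"
      using ex_bij_betw_strict_mono_card[of I] unfolding I_def by auto
    \<comment> \<open>\<open>h\<close> enumerates from 0, subsequences are indexed from 1.\<close>
    define i where "i l = h (l - 1)" for l
    have mono: "strict_mono_on {1..f k} i"
      using h(2) unfolding i_def card by (intro strict_mono_onI strict_mono_onD[OF h(2)[unfolded
        card]]) auto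
    have I: "i l \<in> I" if "l \<in> {1..f k}" for l
      using h(1) that unfolding i_def card by (auto simp: bij_betw_def)
    have "mono_on {1..f k} (\<lambda>k. x (i k))"
    proof (rule mono_onI)
      fix r s assume rs: "r \<in> {1..f k}" "s \<in> {1..f k}" "r \<le> s"
      then have "i r \<le> i s" using mono by (metis order_le_less strict_mono_onD)
      then show "x (i r) \<le> x (i s)"
        using I[OF rs(1)] I[OF rs(2)] assms(1) unfolding I_def by auto
    qed
    moreover have "i ` {1..f k} \<subseteq> {1..n}" using I that unfolding I_def by fastforce
    ultimately show ?thesis unfolding J_def using mono by blast
  qed
  have "J \<subseteq> {..Max (f ` {..n})}"
  proof
    fix j assume "j \<in> J"
    then obtain k where "k \<le> n" "j \<le> f k" using le by blast
    moreover from this have "f k \<le> Max (f ` {..n})" by simp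
    ultimately show "j \<in> {..Max (f ` {..n})}" by (metis atMost_iff le_trans)
  qed
  then have fin: "finite J" by (rule finite_subset) simp
  have "J \<noteq> {}" using ge[of 0] by auto
  with fin have "Max J \<in> J" by simp
  have LI: "longest_incr_subseq x n = Max J" unfolding longest_incr_subseq_def J_def ..
  have "y \<le> real (Max J) \<longleftrightarrow> (\<exists>k\<le>n. y \<le> real (f k))"
  proof
    assume "y \<le> real (Max J)"
    with le[OF \<open>Max J \<in> J\<close>] show "\<exists>k\<le>n. y \<le> real (f k)" by (meson of_nat_le_iff order_trans)
  next
    assume "\<exists>k\<le>n. y \<le> real (f k)"
    then obtain k where "k \<le> n" "y \<le> real (f k)" by blast
    moreover from this have "f k \<le> Max J" using ge fin by simp
    ultimately show "y \<le> real (Max J)" by linarith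
  qed
  then show ?thesis unfolding LI f_def .
qed

text \<open>There are \<open>(k + S k) / 2\<close> letters \<open>\<alpha>\<close> up to
  \<open>k\<close> and \<open>(n - k - (S n - S k)) / 2\<close> letters \<open>\<beta>\<close> after
  it; in the sum \<open>k\<close> cancels, leaving \<open>n / 2 + S k - S n / 2\<close>.\<close>

lemma longest_incr_subseq_walk:
  fixes x :: "nat \<Rightarrow> 'l::linorder"
  assumes "\<alpha> < \<beta>" and x: "\<And>i. i \<in> {1..n} \<Longrightarrow> x i \<in> {\<alpha>, \<beta>}"
  defines "S \<equiv> \<lambda>k. \<Sum>i<k. if x (Suc i) = \<alpha> then 1 else - 1 :: real"
  shows "y \<le> real (longest_incr_subseq x n) - real n / 2 \<longleftrightarrow> (\<exists>k\<le>n. 2 * y \<le> 2 * S k - S n)"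
proof -
  have A: "real (card {i \<in> {1..k}. x i = \<alpha>}) = (real k + S k) / 2" for k
  proof (induction k)
    case (Suc k)
    have "{i \<in> {1..Suc k}. x i = \<alpha>} = (if x (Suc k) = \<alpha> then {Suc k} else {}) \<union> {i \<in> {1..k}. x i
      = \<alpha>}"
      by (auto simp: le_Suc_eq)
    then show ?case using Suc by (simp add: S_def)
  qed (simp add: S_def)
  have B: "real (card {i \<in> {k<..m}. x i = \<beta>}) = (real m - real k - (S m - S k)) / 2"
    if "k \<le> m" "m \<le> n" for k m
    using that
  proof (induction m rule: dec_induct)
    case (step m)
    have "x (Suc m) \<in> {\<alpha>, \<beta>}" using step by (intro x) auto
    moreover have "{i \<in> {k<..Suc m}. x i = \<beta>} = (if x (Suc m) = \<beta> then {Suc m} else {})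
      \<union> {i \<in> {k<..m}. x i = \<beta>}"
      using step.hyps by (auto simp: le_Suc_eq)
    ultimately show ?case using step assms(1) by (auto simp: S_def)
  qed simp
  have "y \<le> real (longest_incr_subseq x n) - real n / 2 \<longleftrightarrow> y + real n / 2
    \<le> real (longest_incr_subseq x n)"
    by linarith
  also have "\<dots> \<longleftrightarrow> (\<exists>k\<le>n. y + real n / 2 \<le>
      real (card {i \<in> {1..k}. x i = \<alpha>} + card {i \<in> {k<..n}. x i = \<beta>}))"
    by (rule longest_incr_subseq_ge_iff[OF assms(1)]) (rule x)
  also have "\<dots> \<longleftrightarrow> (\<exists>k\<le>n. 2 * y \<le> 2 * S k - S n)"
  proof (intro ex_cong1 conj_cong refl)
    fix k assume "k \<le> n"
    then show "y + real n / 2 \<le> real (card {i \<in> {1..k}. x i = \<alpha>} + card {i \<in> {k<..n}. x i = \<beta>})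
      \<longleftrightarrow> 2 * y \<le> 2 * S k - S n"
      unfolding of_nat_add A B[OF \<open>k \<le> n\<close> order_refl] by argo
  qed
  finally show ?thesis .
qed

lemma (in prob_space) simple_walk_of_letters:
  fixes X :: "nat \<Rightarrow> 'a \<Rightarrow> 'l::linorder"
  assumes "\<alpha> < \<beta>"
    and indep: "indep_vars (\<lambda>_. count_space {\<alpha>, \<beta>}) X {1..}"
    and half: "\<And>i. i \<ge> 1 \<Longrightarrow> prob {\<omega> \<in> space M. X i \<omega> = \<alpha>} = 1 / 2"
      "\<And>i. i \<ge> 1 \<Longrightarrow> prob {\<omega> \<in> space M. X i \<omega> = \<beta>} = 1 / 2"
  shows "simple_walk M (\<lambda>i \<omega>. if X (Suc i) \<omega> = \<alpha> then 1 else - 1) n"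
proof -
  define \<xi> :: "nat \<Rightarrow> 'a \<Rightarrow> real" where "\<xi> = (\<lambda>i \<omega>. if X (Suc i) \<omega> = \<alpha> then 1 else - 1)"
  have X: "X (Suc i) \<in> measurable M (count_space {\<alpha>, \<beta>})" for i
    using indep by (auto simp: indep_vars_def)
  have ab: "X (Suc i) \<omega> \<in> {\<alpha>, \<beta>}" if "\<omega> \<in> space M" for i \<omega>
    using measurable_space[OF X that] by simp
  \<comment> \<open>Letters are numbered from 1 and steps from 0; grouping into the singletons
    \<open>{Suc j}\<close> reindexes the independent family.\<close>
  have "indep_vars (\<lambda>j. PiM {Suc j} (\<lambda>_. count_space {\<alpha>, \<beta>})) (\<lambda>j \<omega>. restrict (\<lambda>i. X i \<omega>) {Suc j})
    {..<n}"
    by (rule indep_vars_restrict[OF indep]) (auto simp: disjoint_family_on_def)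
  then have "indep_vars (\<lambda>_. borel) (\<lambda>j \<omega>. (\<lambda>f. if f (Suc j)
    = \<alpha> then 1 else - 1 :: real) (restrict (\<lambda>i. X i \<omega>) {Suc j})) {..<n}"
  proof (rule indep_vars_compose2)
    fix j assume "j \<in> {..<n}"
    have "(\<lambda>f. f (Suc j)) \<in> measurable (PiM {Suc j} (\<lambda>_. count_space {\<alpha>, \<beta>})) (count_space {\<alpha>, \<beta>})"
      by (rule measurable_component_singleton) simp
    then show "(\<lambda>f. if f (Suc j) = \<alpha> then 1 else
      - 1 :: real) \<in> measurable (PiM {Suc j} (\<lambda>_. count_space {\<alpha>, \<beta>})) borel"
      by (rule measurable_compose) simp
  qed
  then have ind: "indep_vars (\<lambda>_. borel) \<xi> {..<n}" by (simp add: \<xi>_def)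
  have \<xi>[measurable]: "\<xi> i \<in> borel_measurable M" for i
    unfolding \<xi>_def by (rule measurable_compose[OF X]) simp
  have p1: "prob {\<omega> \<in> space M. \<xi> i \<omega> = 1} = 1 / 2" for i
  proof -
    have "{\<omega> \<in> space M. \<xi> i \<omega> = 1} = {\<omega> \<in> space M. X (Suc i) \<omega> = \<alpha>}" by (auto simp: \<xi>_def)
    then show ?thesis using half(1)[of "Suc i"] by simp
  qed
  have p2: "prob {\<omega> \<in> space M. \<xi> i \<omega> = - 1} = 1 / 2" for i
  proof -
    have "{\<omega> \<in> space M. \<xi> i \<omega> = - 1} = {\<omega> \<in> space M. X (Suc i) \<omega> = \<beta>}"
      using ab[of _ i] assms(1) by (force simp: \<xi>_def)
    then show ?thesis using half(2)[of "Suc i"] by simp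
  qed
  \<comment> \<open>The sign \<open>c\<close> treats \<open>\<xi>\<close> and \<open>- \<xi>\<close>
    together; the right side is free of \<open>c\<close>, which is the symmetry.\<close>
  have distr: "emeasure (distr M borel (\<lambda>\<omega>. c * \<xi> i \<omega>)) A
    = ennreal ((indicator A 1 + indicator A (- 1)) / 2)"
    if "c = 1 \<or> c = - 1" and [measurable]: "A \<in> sets borel" for c i A
  proof -
    have "{\<omega> \<in> space M. c * \<xi> i \<omega> \<in> A}
      = {\<omega> \<in> space M. \<xi> i \<omega> = 1 \<and> c \<in> A} \<union> {\<omega> \<in> space M. \<xi> i \<omega> = - 1 \<and> - c \<in> A}"
      by (auto simp: \<xi>_def)
    then have "prob {\<omega> \<in> space M. c * \<xi> i \<omega> \<in> A}
      = prob ({\<omega> \<in> space M. \<xi> i \<omega> = 1 \<and> c \<in> A} \<union> {\<omega> \<in> space M. \<xi> i \<omega> = - 1 \<and> - c \<in> A})"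
        by (rule arg_cong)
    also have "\<dots> = prob {\<omega> \<in> space M. \<xi> i \<omega> = 1 \<and> c \<in> A} + prob {\<omega> \<in> space M. \<xi> i \<omega>
      = - 1 \<and> - c \<in> A}"
      by (rule finite_measure_Union) auto
    also have "\<dots> = (indicator A c + indicator A (- c)) / 2"
      using p1[of i] p2[of i] by (auto simp: indicator_def)
    also have "\<dots> = (indicator A 1 + indicator A (- 1)) / 2" using that by auto
    finally have "prob ((\<lambda>\<omega>. c * \<xi> i \<omega>) -` A \<inter> space M) = (indicator A 1 + indicator A (- 1)) / 2"
      by (simp add: vimage_def Int_def conj_commute)
    then show ?thesis by (subst emeasure_distr) (auto simp: emeasure_eq_measure)
  qed
  have "distr M borel (\<lambda>\<omega>. - \<xi> i \<omega>) = distr M borel (\<xi> i)" for i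
    using distr[of "- 1" _ i] distr[of 1 _ i] by (intro measure_eqI) auto
  then have "simple_walk M \<xi> n"
    using ind p1 by unfold_locales (auto simp: \<xi>_def)
  then show ?thesis unfolding \<xi>_def .
qed

theorem theorem5p1:
  fixes M :: "'a measure" and X :: "nat \<Rightarrow> 'a \<Rightarrow> 'l::linorder" and \<alpha>\<^sub>1 \<alpha>\<^sub>2 :: 'l
    and N :: "'b measure" and B :: "real \<Rightarrow> 'b \<Rightarrow> real" and n :: nat
  assumes "prob_space M"
    and "\<alpha>\<^sub>1 < \<alpha>\<^sub>2"
    and "prob_space.indep_vars M (\<lambda>_. count_space {\<alpha>\<^sub>1, \<alpha>\<^sub>2}) X {1..}"
    and "\<And>i. i \<ge> 1 \<Longrightarrow> measure M {\<omega> \<in> space M. X i \<omega> = \<alpha>\<^sub>1} = 1 / 2"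
    and "\<And>i. i \<ge> 1 \<Longrightarrow> measure M {\<omega> \<in> space M. X i \<omega> = \<alpha>\<^sub>2} = 1 / 2"
    and "standard_brownian_motion N B"
    and "n \<ge> 1"
  shows "(SUP x::real.
      \<bar>measure M {\<omega> \<in> space M.
          (real (longest_incr_subseq (\<lambda>i. X i \<omega>) n) - real n / 2) / sqrt (real n) \<ge> x}
        - measure N {\<omega> \<in> space N. - B 1 \<omega> / 2 + (SUP t\<in>{0..1}. B t \<omega>) \<ge> x}\<bar>)
    \<le> 24 / sqrt (real n)"
proof (rule cSUP_least)
  interpret M: prob_space M by fact
  interpret N: standard_brownian_motion N B by fact
  define \<xi> :: "nat \<Rightarrow> 'a \<Rightarrow> real" where "\<xi> = (\<lambda>i \<omega>. if X (Suc i) \<omega> = \<alpha>\<^sub>1 then 1 else - 1)"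
  interpret W: simple_walk M \<xi> n
    unfolding \<xi>_def by (rule M.simple_walk_of_letters[OF assms(2-5)])
  have X: "X i \<omega> \<in> {\<alpha>\<^sub>1, \<alpha>\<^sub>2}" if "\<omega> \<in> space M" "i \<in> {1..n}" for i \<omega>
  proof -
    have "X i \<in> measurable M (count_space {\<alpha>\<^sub>1, \<alpha>\<^sub>2})"
      using assms(3) that by (auto simp: M.indep_vars_def)
    from measurable_space[OF this that(1)] show ?thesis by simp
  qed
  fix x :: real
  have n: "0 < sqrt (real n)" using assms(7) by simp
  let ?p = "measure M {\<omega> \<in> space M. (real (longest_incr_subseq (\<lambda>i. X i \<omega>) n)
    - real n / 2) / sqrt (real n) \<ge> x}"
  let ?q = "measure N {\<omega> \<in> space N. - B 1 \<omega> / 2 + (SUP t\<in>{0..1}. B t \<omega>) \<ge> x}"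
  have p: "?p = measure M {\<omega> \<in> space M. (2 * x) * sqrt (real n) \<le> 2 * W.peak \<omega> - W.S n \<omega>}"
  proof (intro arg_cong[where f="measure M"] Collect_cong conj_cong refl)
    fix \<omega> assume \<omega>: "\<omega> \<in> space M"
    have S: "W.S k \<omega> = (\<Sum>i<k. if X (Suc i) \<omega> = \<alpha>\<^sub>1 then 1 else - 1)" for k
      unfolding W.S_def by (simp add: \<xi>_def)
    have "x \<le> (real (longest_incr_subseq (\<lambda>i. X i \<omega>) n) - real n / 2) / sqrt (real n)
      \<longleftrightarrow> x * sqrt (real n) \<le> real (longest_incr_subseq (\<lambda>i. X i \<omega>) n) - real n / 2"
      using n by (simp add: pos_le_divide_eq)
    also have "\<dots> \<longleftrightarrow> (\<exists>k\<le>n. 2 * (x * sqrt (real n)) \<le> 2 * W.S k \<omega> - W.S n \<omega>)"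
      unfolding S by (rule longest_incr_subseq_walk[OF assms(2) X[OF \<omega>]])
    \<comment> \<open>Isolating \<open>W.S k\<close> turns the existential into a bound on
      \<open>W.peak\<close>.\<close>
    also have "\<dots> \<longleftrightarrow> (\<exists>k\<le>n. (2 * x * sqrt (real n) + W.S n \<omega>) / 2 \<le> W.S k \<omega>)"
      by (intro ex_cong1 conj_cong refl) argo
    also have "\<dots> \<longleftrightarrow> (2 * x * sqrt (real n) + W.S n \<omega>) / 2 \<le> W.peak \<omega>"
      by (rule W.peak_ge_iff[symmetric])
    also have "\<dots> \<longleftrightarrow> (2 * x) * sqrt (real n) \<le> 2 * W.peak \<omega> - W.S n \<omega>" by argo
    finally show "x \<le> (real (longest_incr_subseq (\<lambda>i. X i \<omega>) n) - real n / 2) / sqrt (real n)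
      \<longleftrightarrow> (2 * x) * sqrt (real n) \<le> 2 * W.peak \<omega> - W.S n \<omega>" .
  qed
  have q: "?q = measure N {\<omega> \<in> space N. 2 * x \<le> 2 * N.path_max \<omega> - B 1 \<omega>}"
    unfolding N.path_max_def by (intro arg_cong[where f="measure N"] Collect_cong conj_cong refl)
      argo
  show "\<bar>?p - ?q\<bar> \<le> 24 / sqrt (real n)"
  proof (cases "x \<le> 0")
    \<comment> \<open>Both functionals are nonnegative, so both events are certain.\<close>
    case True
    have "{\<omega> \<in> space M. (2 * x) * sqrt (real n) \<le> 2 * W.peak \<omega> - W.S n \<omega>} = space M"
    proof -
      have "(2 * x) * sqrt (real n) \<le> 2 * W.peak \<omega> - W.S n \<omega>" if "\<omega> \<in> space M" for \<omega>
      proof -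
        have "(2 * x) * sqrt (real n) \<le> 0" using True n by (simp add: mult_nonpos_nonneg)
        also have "0 \<le> 2 * W.peak \<omega> - W.S n \<omega>" using W.pitman_support[OF that] by auto
        finally show ?thesis .
      qed
      then show ?thesis by auto
    qed
    then have "?p = 1" unfolding p by (simp add: M.prob_space)
    moreover have "?q = 1" unfolding q using True by (intro N.prob_bessel_nonpos) simp
    ultimately show ?thesis by simp
  next
    case False
    then have x: "0 < 2 * x" by simp
    show ?thesis
    proof (cases "576 \<le> n")
      case True
      have "\<bar>?p - ?q\<bar> \<le> 14 / sqrt (real n)"
        unfolding p q N.prob_bessel[OF x] by (rule W.pitman_close[OF True x])
      also have "\<dots> \<le> 24 / sqrt (real n)" using n by (intro divide_right_mono) auto
      finally show ?thesis .
    next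
      case False
      have "\<bar>?p - ?q\<bar> \<le> 1"
        unfolding abs_le_iff using measure_nonneg[of M] measure_nonneg[of N] M.prob_le_1 N.prob_le_1
        by (smt (verit, best))
      also have "1 \<le> 24 / sqrt (real n)"
      proof -
        have "sqrt (real n) \<le> 24" using False by (intro real_le_lsqrt) auto
        then show ?thesis using n by simp
      qed
      finally show ?thesis .
    qed
  qed
qed simp

end
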